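(* Let $r(t,u)=\exp\big(-\tfrac12(t-u)^2\big)$, $t,u\in\mathbb{R}$, be the Gaussian kernel. The functions $$\psi_m(t)=\bigg(\frac{2\sqrt2}{3}\bigg)^{1/2}\sqrt{\frac{1}{6^m m!}}\;e^{-t^2/3}\,\mathrm{H}_m\bigg(\frac{2t}{\sqrt3}\bigg)\quad\text{for } m\in\mathbb{N}_0$$ form an orthonormal basis of the reproducing kernel Hilbert space of $r$, and the kernel has the pointwise convergent expansion $$r(t,u)=\sum_{m=0}^\infty\psi_m(t)\psi_m(u)\quad\text{for all } t,u\in\mathbb{R}.$$
   Context: $\mathrm{H}_m$ is the $m$th physicist's Hermite polynomial, $\mathrm{H}_m(t)=m!\sum_{k=0}^{\lfloor m/2\rfloor}\frac{(-1)^k}{k!(m-2k)!}(2t)^{m-2k}$, and $\mathbb{N}_0=\{0,1,2,\ldots\}$. *)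

theory Defs
  imports "HOL-Analysis.Analysis"
begin

section \<open>Hilbert spaces of real-valued functions\<close>

text \<open>
  A space of functions is given by its carrier \<open>H\<close> and its inner product \<open>ip\<close>. The inner
  product is a total function; it is required to vanish outside \<open>H\<close>, so that
  a pair \<open>(H, ip)\<close> is determined by the space it represents.
\<close>

definition inner_product_function_space ::
  "('a \<Rightarrow> real) set \<Rightarrow> (('a \<Rightarrow> real) \<Rightarrow> ('a \<Rightarrow> real) \<Rightarrow> real) \<Rightarrow> bool" where
  "inner_product_function_space H ip \<longleftrightarrow>
     (\<lambda>x. 0) \<in> H \<and>
     (\<forall>f\<in>H. \<forall>g\<in>H. (\<lambda>x. f x + g x) \<in> H) \<and>
     (\<forall>c. \<forall>f\<in>H. (\<lambda>x. c * f x) \<in> H) \<and>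
     (\<forall>f\<in>H. \<forall>g\<in>H. ip f g = ip g f) \<and>
     (\<forall>f\<in>H. \<forall>g\<in>H. \<forall>h\<in>H. ip (\<lambda>x. f x + g x) h = ip f h + ip g h) \<and>
     (\<forall>c. \<forall>f\<in>H. \<forall>g\<in>H. ip (\<lambda>x. c * f x) g = c * ip f g) \<and>
     (\<forall>f\<in>H. 0 \<le> ip f f) \<and>
     (\<forall>f\<in>H. ip f f = 0 \<longrightarrow> f = (\<lambda>x. 0)) \<and>
     (\<forall>f g. f \<notin> H \<or> g \<notin> H \<longrightarrow> ip f g = 0)"

definition ip_dist ::
  "(('a \<Rightarrow> real) \<Rightarrow> ('a \<Rightarrow> real) \<Rightarrow> real) \<Rightarrow> ('a \<Rightarrow> real) \<Rightarrow> ('a \<Rightarrow> real) \<Rightarrow> real" where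
  "ip_dist ip f g = sqrt (ip (\<lambda>x. f x - g x) (\<lambda>x. f x - g x))"

definition hilbert_function_space ::
  "('a \<Rightarrow> real) set \<Rightarrow> (('a \<Rightarrow> real) \<Rightarrow> ('a \<Rightarrow> real) \<Rightarrow> real) \<Rightarrow> bool" where
  "hilbert_function_space H ip \<longleftrightarrow>
     inner_product_function_space H ip \<and> Metric_space.mcomplete H (ip_dist ip)"

definition function_span :: "('i \<Rightarrow> 'a \<Rightarrow> real) \<Rightarrow> ('a \<Rightarrow> real) set" where
  "function_span b = {\<lambda>x. \<Sum>i\<in>I. c i * b i x | I c. finite I}"

definition orthonormal_basis ::
  "('a \<Rightarrow> real) set \<times> (('a \<Rightarrow> real) \<Rightarrow> ('a \<Rightarrow> real) \<Rightarrow> real) \<Rightarrow> ('i \<Rightarrow> 'a \<Rightarrow> real) \<Rightarrow> bool" where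
  "orthonormal_basis = (\<lambda>(H, ip) b.
     hilbert_function_space H ip \<and>
     (\<forall>i. b i \<in> H) \<and>
     (\<forall>i j. ip (b i) (b j) = (if i = j then 1 else 0)) \<and>
     Metric_space.mtopology H (ip_dist ip) closure_of function_span b = H)"

text \<open>
  The library's completeness and closure are meaningful here: \<^term>\<open>ip_dist ip\<close> is a metric
  on the carrier.
\<close>

lemma Metric_space_ip_dist:
  assumes "inner_product_function_space H ip"
  shows "Metric_space H (ip_dist ip)"
proof -
  note ax = assms[unfolded inner_product_function_space_def]
  note zero = ax[THEN conjunct1]
  note ax = ax[THEN conjunct2]
  note add = ax[THEN conjunct1, rule_format]
  note ax = ax[THEN conjunct2]
  note scale = ax[THEN conjunct1, rule_format]
  note ax = ax[THEN conjunct2]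
  note sym = ax[THEN conjunct1, rule_format]
  note ax = ax[THEN conjunct2]
  note add_l = ax[THEN conjunct1, rule_format]
  note ax = ax[THEN conjunct2]
  note scale_l = ax[THEN conjunct1, rule_format]
  note ax = ax[THEN conjunct2]
  note nonneg_H = ax[THEN conjunct1, rule_format]
  note ax = ax[THEN conjunct2]
  note definite = ax[THEN conjunct1, rule_format]
  note out = ax[THEN conjunct2, rule_format]
  have nonneg: "0 \<le> ip f f" for f
    using nonneg_H out by (cases "f \<in> H") auto
  have diff: "(\<lambda>x. f x - g x) \<in> H" if "f \<in> H" "g \<in> H" for f g
    using add[OF that(1) scale[OF that(2), where c = "-1"]] by simp
  have neg: "ip (\<lambda>x. - f x) (\<lambda>x. - f x) = ip f f" for f
  proof (cases "f \<in> H")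
    case True
    have m: "(\<lambda>x. - f x) \<in> H" using scale[OF True, where c = "-1"] by simp
    show ?thesis
      using scale_l[OF True m, where c = "-1"] scale_l[OF True True, where c = "-1"] sym[OF True m] by simp
  next
    case False
    have "(\<lambda>x. - f x) \<notin> H" using scale[where c = "-1" and f = "\<lambda>x. - f x"] False by auto
    then show ?thesis using False out by simp
  qed
  have comb: "ip (\<lambda>x. a * f x + b * g x) (\<lambda>x. a * f x + b * g x)
      = a\<^sup>2 * ip f f + 2 * a * b * ip f g + b\<^sup>2 * ip g g" if f: "f \<in> H" and g: "g \<in> H" for a b f g
  proof -
    define h where "h = (\<lambda>x. a * f x + b * g x)"
    have h: "h \<in> H" unfolding h_def by (intro add scale f g)
    have E: "ip h k = a * ip f k + b * ip g k" if "k \<in> H" for k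
      unfolding h_def by (simp add: add_l scale_l scale f g that)
    show ?thesis
      unfolding h_def[symmetric]
      using E[OF h] E[OF f] E[OF g] sym[OF h f] sym[OF h g] sym[OF f g]
      by (simp add: power2_eq_square algebra_simps)
  qed
  have CS: "ip f g \<le> sqrt (ip f f) * sqrt (ip g g)" if f: "f \<in> H" and g: "g \<in> H" for f g
  proof -
    define A B where "A = sqrt (ip f f)" and "B = sqrt (ip g g)"
    have A2: "A\<^sup>2 = ip f f" "A \<ge> 0" and B2: "B\<^sup>2 = ip g g" "B \<ge> 0"
      using nonneg by (auto simp: A_def B_def)
    show ?thesis
    proof (cases "A = 0 \<or> B = 0")
      case True
      then have "f = (\<lambda>x. 0) \<or> g = (\<lambda>x. 0)" using definite f g A2 B2 by force
      moreover have "ip (\<lambda>x. 0) k = 0" if "k \<in> H" for k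
        using scale_l[OF zero that, where c = 0] by simp
      ultimately have "ip f g = 0" using sym f g by metis
      then show ?thesis using nonneg by simp
    next
      case False
      then have "A * B > 0" using A2 B2 by auto
      moreover have "0 \<le> 2 * (A * B) * (A * B - ip f g)"
        using nonneg[of "\<lambda>x. B * f x + (- A) * g x"] unfolding comb[OF f g]
        by (simp add: A2(1)[symmetric] B2(1)[symmetric] power2_eq_square algebra_simps)
      ultimately have "0 \<le> A * B - ip f g" by (simp add: zero_le_mult_iff)
      then show ?thesis by (simp add: A_def B_def)
    qed
  qed
  have tri: "sqrt (ip (\<lambda>x. f x + g x) (\<lambda>x. f x + g x)) \<le> sqrt (ip f f) + sqrt (ip g g)"
    if f: "f \<in> H" and g: "g \<in> H" for f g
  proof (rule real_le_lsqrt)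
    show "ip (\<lambda>x. f x + g x) (\<lambda>x. f x + g x) \<le> (sqrt (ip f f) + sqrt (ip g g))\<^sup>2"
      using comb[OF f g, of 1 1] CS[OF f g] nonneg by (simp add: power2_sum)
  qed (use nonneg in simp_all)
  show ?thesis
  proof
    fix f g
    show "0 \<le> ip_dist ip f g" by (simp add: ip_dist_def nonneg)
    show "ip_dist ip f g = ip_dist ip g f"
      using neg[of "\<lambda>x. f x - g x"] by (simp add: ip_dist_def)
  next
    fix f g assume fg: "f \<in> H" "g \<in> H"
    have "ip (\<lambda>x. 0) (\<lambda>x. 0) = 0" using scale_l[OF zero zero, where c = 0] by simp
    moreover have "f = g" if "ip_dist ip f g = 0"
    proof
      fix x
      have "(\<lambda>x. f x - g x) = (\<lambda>x. 0)"
        using that by (intro definite diff fg) (simp add: ip_dist_def)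
      from fun_cong[OF this, of x] show "f x = g x" by simp
    qed
    ultimately show "ip_dist ip f g = 0 \<longleftrightarrow> f = g" by (auto simp: ip_dist_def)
  next
    fix f g h assume "f \<in> H" "g \<in> H" "h \<in> H"
    then show "ip_dist ip f h \<le> ip_dist ip f g + ip_dist ip g h"
      using tri[OF diff[of f g] diff[of g h]] by (simp add: ip_dist_def)
  qed
qed

section \<open>Reproducing kernel Hilbert spaces\<close>

definition is_rkhs ::
  "('a \<Rightarrow> 'a \<Rightarrow> real) \<Rightarrow> ('a \<Rightarrow> real) set \<times> (('a \<Rightarrow> real) \<Rightarrow> ('a \<Rightarrow> real) \<Rightarrow> real) \<Rightarrow> bool" where
  "is_rkhs k = (\<lambda>(H, ip).
     hilbert_function_space H ip \<and>
     (\<forall>t. (\<lambda>s. k s t) \<in> H) \<and>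
     (\<forall>f\<in>H. \<forall>t. f t = ip f (\<lambda>s. k s t)))"

text \<open>
  By the Moore--Aronszajn theorem a positive semidefinite kernel has exactly one such space.
\<close>

definition rkhs ::
  "('a \<Rightarrow> 'a \<Rightarrow> real) \<Rightarrow> ('a \<Rightarrow> real) set \<times> (('a \<Rightarrow> real) \<Rightarrow> ('a \<Rightarrow> real) \<Rightarrow> real)" where
  "rkhs k = (THE V. is_rkhs k V)"

section \<open>The Gaussian kernel and the basis functions\<close>

definition gaussian_kernel :: "real \<Rightarrow> real \<Rightarrow> real" where
  "gaussian_kernel t u = exp (- (1/2) * (t - u)\<^sup>2)"

definition hermite :: "nat \<Rightarrow> real \<Rightarrow> real" where
  "hermite m t =
     fact m * (\<Sum>k = 0..m div 2. (-1) ^ k / (fact k * fact (m - 2 * k)) * (2 * t) ^ (m - 2 * k))"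

definition psi :: "nat \<Rightarrow> real \<Rightarrow> real" where
  "psi m t =
     sqrt (2 * sqrt 2 / 3) * sqrt (1 / (6 ^ m * fact m)) * exp (- t\<^sup>2 / 3) * hermite m (2 * t / sqrt 3)"

end

theory Submission
  imports Defs "HOL-Probability.Distributions"
begin

text \<open>
  The expansion of the kernel is Mehler's formula at the parameter \<open>1/3\<close>. In the variables
  \<open>x = 2t / sqrt 3\<close> and \<open>y = 2u / sqrt 3\<close> the Gaussian factors \<open>exp (- t\<^sup>2 / 3)\<close> and
  \<open>exp (- u\<^sup>2 / 3)\<close> complete the exponent of Mehler's closed form to \<open>- (t - u)\<^sup>2 / 2\<close>, and the
  factor \<open>2 * sqrt 2 / 3 = sqrt (1 - 1/9)\<close> cancels its denominator
  (lemma \<open>gaussian_kernel_expansion\<close>).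

  Mehler's formula (theorem \<open>mehler\<close>) is proved for fixed \<open>x\<close> and \<open>y\<close> as an identity between functions
  of the parameter \<open>r\<close>. The three-term recurrence of the Hermite polynomials turns into
  a first-order linear differential equation in \<open>r\<close> for the power series on the left
  (lemma \<open>mehler_fps_ode\<close>); the closed form satisfies the same equation with the same value at
  \<open>0\<close>. The recurrence also shows that \<open>hermite n x / sqrt (2 ^ n * fact n)\<close> grows more slowly than every
  geometric sequence of ratio above \<open>1\<close>, so that the series converges on the whole unit disc.

  An expansion \<open>k t u = (\<Sum>m. b m t * b m u)\<close> alone makes \<open>b\<close> a Parseval frame of the reproducing
  kernel Hilbert space of \<open>k\<close>; it is an orthonormal basis exactly if no nonzero square-summable
  sequence \<open>a\<close> satisfies \<open>(\<Sum>m. a m * b m t) = 0\<close> for all \<open>t\<close>. In that case the synthesis map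
  \<open>a \<mapsto> (\<Sum>m. a m * b m)\<close> is injective on the space of square-summable sequences, its image with the
  transported inner product is a Hilbert space with kernel \<open>k\<close>, and the unit sequences are mapped
  to \<open>b\<close> (theorem \<open>orthonormal_basis_rkhs\<close>). As \<open>rkhs\<close> is a definite description, this also needs the
  uniqueness of the reproducing kernel Hilbert space (theorem \<open>is_rkhs_unique\<close>).

  For the functions \<open>psi\<close> the independence follows from the orthogonality of the Hermite polynomials
  for the weight \<open>exp (- x\<^sup>2)\<close>: a vanishing series is integrated term by term against a Hermite
  polynomial. The exchange of limit and integral is justified by dominated convergence, because
  \<open>(\<Sum>m. (psi m t)\<^sup>2) = gaussian_kernel t t = 1\<close> and the Cauchy--Schwarz inequality bound all partial
  sums by the norm of \<open>a\<close> (lemma \<open>psi_l2_independent\<close>).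
\<close>

section \<open>Inner product spaces of functions\<close>

locale inner_product_functions =
  fixes H :: "('a \<Rightarrow> real) set" and ip :: "('a \<Rightarrow> real) \<Rightarrow> ('a \<Rightarrow> real) \<Rightarrow> real"
  assumes inner_product: "inner_product_function_space H ip"
begin

lemma zero_mem: "(\<lambda>x. 0) \<in> H"
  and add_mem: "f \<in> H \<Longrightarrow> g \<in> H \<Longrightarrow> (\<lambda>x. f x + g x) \<in> H"
  and scale_mem: "f \<in> H \<Longrightarrow> (\<lambda>x. c * f x) \<in> H"
  and ip_commute: "f \<in> H \<Longrightarrow> g \<in> H \<Longrightarrow> ip f g = ip g f"
  and add_left: "f \<in> H \<Longrightarrow> g \<in> H \<Longrightarrow> h \<in> H \<Longrightarrow> ip (\<lambda>x. f x + g x) h = ip f h + ip g h"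
  and scale_left: "f \<in> H \<Longrightarrow> g \<in> H \<Longrightarrow> ip (\<lambda>x. c * f x) g = c * ip f g"
  and definite: "f \<in> H \<Longrightarrow> ip f f = 0 \<Longrightarrow> f = (\<lambda>x. 0)"
  and outside: "f \<notin> H \<or> g \<notin> H \<Longrightarrow> ip f g = 0"
  using inner_product unfolding inner_product_function_space_def by blast+

lemma ip_nonneg: "0 \<le> ip f f"
  using inner_product by (cases "f \<in> H") (simp_all add: inner_product_function_space_def)

lemma diff_mem: "f \<in> H \<Longrightarrow> g \<in> H \<Longrightarrow> (\<lambda>x. f x - g x) \<in> H"
  using add_mem[OF _ scale_mem[where c = "-1"]] by simp

lemma diff_left: "f \<in> H \<Longrightarrow> g \<in> H \<Longrightarrow> h \<in> H \<Longrightarrow> ip (\<lambda>x. f x - g x) h = ip f h - ip g h"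
  using add_left[of f "\<lambda>x. -1 * g x" h] scale_mem[of g "-1"] scale_left[of g h "-1"] by simp

lemma sum_mem: "finite I \<Longrightarrow> (\<And>i. i \<in> I \<Longrightarrow> f i \<in> H) \<Longrightarrow> (\<lambda>x. \<Sum>i\<in>I. c i * f i x) \<in> H"
  by (induction I rule: finite_induct) (simp_all add: zero_mem add_mem scale_mem)

lemma ip_zero_left: "f \<in> H \<Longrightarrow> ip (\<lambda>x. 0) f = 0"
  using scale_left[OF zero_mem, of f 0] by simp

lemma sum_left:
  "finite I \<Longrightarrow> (\<And>i. i \<in> I \<Longrightarrow> f i \<in> H) \<Longrightarrow> g \<in> H \<Longrightarrow>
     ip (\<lambda>x. \<Sum>i\<in>I. c i * f i x) g = (\<Sum>i\<in>I. c i * ip (f i) g)"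
proof (induction I rule: finite_induct)
  case (insert i I)
  then show ?case
    using add_left[of "\<lambda>x. c i * f i x" "\<lambda>x. \<Sum>i\<in>I. c i * f i x" g]
    by (simp add: scale_mem sum_mem scale_left)
qed (simp add: ip_zero_left)

lemma ip_comb:
  assumes f: "f \<in> H" and g: "g \<in> H"
  shows "ip (\<lambda>x. a * f x + b * g x) (\<lambda>x. a * f x + b * g x)
      = a\<^sup>2 * ip f f + 2 * a * b * ip f g + b\<^sup>2 * ip g g"
proof -
  define h where "h = (\<lambda>x. a * f x + b * g x)"
  have h: "h \<in> H" unfolding h_def by (intro add_mem scale_mem f g)
  have E: "ip h k = a * ip f k + b * ip g k" if "k \<in> H" for k
    unfolding h_def by (simp add: add_left scale_left scale_mem f g that)
  show ?thesis
    unfolding h_def[symmetric]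
    using E[OF h] E[OF f] E[OF g] ip_commute[OF h f] ip_commute[OF h g] ip_commute[OF f g]
    by (simp add: power2_eq_square algebra_simps)
qed

lemma ip_polarize:
  assumes "f \<in> H" "g \<in> H"
  shows "ip f g = (ip (\<lambda>x. f x + g x) (\<lambda>x. f x + g x) - ip f f - ip g g) / 2"
  using ip_comb[OF assms, of 1 1] by simp

lemma Cauchy_Schwarz:
  assumes f: "f \<in> H" and g: "g \<in> H"
  shows "\<bar>ip f g\<bar> \<le> sqrt (ip f f) * sqrt (ip g g)"
proof -
  have "(ip f g)\<^sup>2 \<le> ip f f * ip g g"
  proof (cases "ip g g = 0")
    case True
    then show ?thesis
      using definite[OF g] ip_zero_left[OF f] ip_commute[OF f g] by auto
  next
    case False
    have "0 \<le> ip g g * (ip f f * ip g g - (ip f g)\<^sup>2)"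
      using ip_nonneg[of "\<lambda>x. ip g g * f x + (- ip f g) * g x"] unfolding ip_comb[OF f g]
      by (simp add: power2_eq_square algebra_simps)
    then show ?thesis using False ip_nonneg[of g] by (simp add: zero_le_mult_iff)
  qed
  then have "\<bar>ip f g\<bar> \<le> sqrt (ip f f * ip g g)"
    by (simp add: real_le_rsqrt)
  then show ?thesis by (simp add: real_sqrt_mult)
qed

sublocale Metric_space H "ip_dist ip"
  by (rule Metric_space_ip_dist[OF inner_product])

text \<open>
  The second part with \<open>g\<close> a kernel section says that convergence in norm implies pointwise
  convergence in a reproducing kernel Hilbert space.
\<close>

lemma limit_imp_ip_tendsto:
  assumes "limitin mtopology \<sigma> f sequentially" "range \<sigma> \<subseteq> H"
  shows "(\<lambda>n. ip (\<sigma> n) (\<sigma> n)) \<longlonglongrightarrow> ip f f"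
    and "g \<in> H \<Longrightarrow> (\<lambda>n. ip (\<sigma> n) g) \<longlonglongrightarrow> ip f g"
proof -
  have f: "f \<in> H" and \<sigma>: "\<sigma> n \<in> H" for n
    using assms by (auto simp: limitin_metric)
  have d: "(\<lambda>n. ip_dist ip (\<sigma> n) f) \<longlonglongrightarrow> 0"
  proof (rule LIMSEQ_I)
    fix r :: real assume "r > 0"
    then obtain N where "\<And>n. n \<ge> N \<Longrightarrow> ip_dist ip (\<sigma> n) f < r"
      using assms(1) unfolding limit_metric_sequentially by blast
    then show "\<exists>no. \<forall>n\<ge>no. norm (ip_dist ip (\<sigma> n) f - 0) < r"
      by auto
  qed
  show 1: "(\<lambda>n. ip (\<sigma> n) g) \<longlonglongrightarrow> ip f g" if g: "g \<in> H" for g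
  proof -
    have "(\<lambda>n. ip (\<sigma> n) g - ip f g) \<longlonglongrightarrow> 0"
    proof (rule tendsto_rabs_zero_cancel, rule tendsto_sandwich[OF _ _ tendsto_const])
      show "\<forall>\<^sub>F n in sequentially. \<bar>ip (\<sigma> n) g - ip f g\<bar> \<le> ip_dist ip (\<sigma> n) f * sqrt (ip g g)"
        using Cauchy_Schwarz[OF diff_mem[OF \<sigma> f] g]
        by (simp add: diff_left \<sigma> f g ip_dist_def)
      show "(\<lambda>n. ip_dist ip (\<sigma> n) f * sqrt (ip g g)) \<longlonglongrightarrow> 0"
        using tendsto_mult_right[OF d, of "sqrt (ip g g)"] by simp
    qed simp
    then show ?thesis by (rule LIM_zero_cancel)
  qed
  have "ip (\<sigma> n) (\<sigma> n) = (ip_dist ip (\<sigma> n) f)\<^sup>2 + 2 * ip (\<sigma> n) f - ip f f" for n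
    using ip_comb[OF \<sigma>[of n] f, of 1 "-1"] ip_nonneg[of "\<lambda>x. \<sigma> n x - f x"]
    by (simp add: ip_dist_def)
  moreover have "(\<lambda>n. (ip_dist ip (\<sigma> n) f)\<^sup>2 + 2 * ip (\<sigma> n) f - ip f f) \<longlonglongrightarrow> 0\<^sup>2 + 2 * ip f f - ip f f"
    by (intro tendsto_intros d 1 f)
  ultimately show "(\<lambda>n. ip (\<sigma> n) (\<sigma> n)) \<longlonglongrightarrow> ip f f"
    by simp
qed

end

section \<open>Uniqueness of the reproducing kernel Hilbert space\<close>

lemma is_rkhsD:
  assumes "is_rkhs k (H, ip)"
  shows "inner_product_functions H ip" "Metric_space.mcomplete H (ip_dist ip)"
    "(\<lambda>s. k s t) \<in> H" "f \<in> H \<Longrightarrow> f t = ip f (\<lambda>s. k s t)"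
  using assms by (auto simp: is_rkhs_def hilbert_function_space_def inner_product_functions_def)

lemma function_span_add:
  assumes "f \<in> function_span b" "g \<in> function_span b"
  shows "(\<lambda>x. f x + c * g x) \<in> function_span b"
proof -
  obtain I d J e where fin: "finite I" "finite J"
    and f: "f = (\<lambda>x. \<Sum>i\<in>I. d i * b i x)" and g: "g = (\<lambda>x. \<Sum>i\<in>J. e i * b i x)"
    using assms by (auto simp: function_span_def)
  have "(\<lambda>x. f x + c * g x) =
    (\<lambda>x. \<Sum>i\<in>I \<union> J. ((if i \<in> I then d i else 0) + c * (if i \<in> J then e i else 0)) * b i x)"
  proof
    fix x
    have "f x = (\<Sum>i\<in>I \<union> J. (if i \<in> I then d i else 0) * b i x)"
      unfolding f by (rule sum.mono_neutral_cong_left) (use fin in auto)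
    moreover have "g x = (\<Sum>i\<in>I \<union> J. (if i \<in> J then e i else 0) * b i x)"
      unfolding g by (rule sum.mono_neutral_cong_left) (use fin in auto)
    ultimately show "f x + c * g x =
      (\<Sum>i\<in>I \<union> J. ((if i \<in> I then d i else 0) + c * (if i \<in> J then e i else 0)) * b i x)"
      by (simp add: sum_distrib_left sum.distrib algebra_simps)
  qed
  moreover have "finite (I \<union> J)" using fin by simp
  ultimately show ?thesis unfolding function_span_def mem_Collect_eq
    by (intro exI conjI)
qed

lemma function_span_zero: "(\<lambda>x. 0) \<in> function_span b"
  unfolding function_span_def by (auto intro!: exI[of _ "{}"])

lemma function_span_base: "b i \<in> function_span b"
  unfolding function_span_def by (auto intro!: exI[of _ "{i}"] exI[of _ "\<lambda>_. 1"])

lemma (in inner_product_functions) function_span_subset: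
  assumes "\<And>i. b i \<in> H"
  shows "function_span b \<subseteq> H"
  using assms by (auto simp: function_span_def intro!: sum_mem)

text \<open>
  A function orthogonal to all kernel sections vanishes by the reproducing property. Density of
  their span follows as in the projection theorem: a sequence in the span that
  minimizes the distance to \<open>f\<close> is Cauchy by the parallelogram law, and the difference between \<open>f\<close> and its limit is
  orthogonal to the span.
\<close>

lemma kernel_span_dense:
  assumes k: "is_rkhs k (H, ip)" and f: "f \<in> H"
  obtains v where "\<And>n. v n \<in> function_span (\<lambda>t s. k s t)"
    "limitin (Metric_space.mtopology H (ip_dist ip)) v f sequentially"
proof -
  interpret inner_product_functions H ip using is_rkhsD(1)[OF k] .
  define V where "V = function_span (\<lambda>t s. k s t)"
  have VH: "V \<subseteq> H"
    unfolding V_def by (rule function_span_subset) (rule is_rkhsD(3)[OF k])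
  let ?N = "\<lambda>v. ip (\<lambda>x. f x - v x) (\<lambda>x. f x - v x)"
  define D where "D = (INF v\<in>V. ?N v)"
  have D_le: "D \<le> ?N v" if "v \<in> V" for v
    unfolding D_def by (rule cINF_lower[OF _ that]) (auto intro!: bdd_belowI[of _ 0] ip_nonneg)
  have "\<exists>v\<in>V. ?N v < D + 1 / Suc n" for n
  proof (rule ccontr)
    assume "\<not> ?thesis"
    then have "D + 1 / Suc n \<le> (INF v\<in>V. ?N v)"
      using function_span_zero[of "\<lambda>t s. k s t"] by (intro cINF_greatest) (auto simp: V_def not_less)
    then have "D + 1 / Suc n \<le> D" by (simp add: D_def)
    then show False by simp
  qed
  then obtain v where v: "\<And>n. v n \<in> V" "\<And>n. ?N (v n) < D + 1 / Suc n" by metis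
  have vH: "v n \<in> H" for n using v VH by auto
  \<comment> \<open>Parallelogram law; the midpoint of two elements of \<open>V\<close> has squared distance at least \<open>D\<close> from \<open>f\<close>.\<close>
  have para: "ip (\<lambda>x. v n x - v m x) (\<lambda>x. v n x - v m x) \<le> 2 / Suc n + 2 / Suc m" for n m
  proof -
    define p q where "p = (\<lambda>x. f x - v n x)" and "q = (\<lambda>x. f x - v m x)"
    have pq: "p \<in> H" "q \<in> H" by (auto simp: p_def q_def intro!: diff_mem f vH)
    have "(\<lambda>x. (v n x + 1 * v m x)) \<in> V"
      unfolding V_def by (rule function_span_add) (use v in \<open>auto simp: V_def\<close>)
    from function_span_add[OF function_span_zero this[unfolded V_def], of "1/2"]
    have "(\<lambda>x. (v n x + v m x) / 2) \<in> V" by (simp add: V_def)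
    from D_le[OF this] have "D \<le> ip (\<lambda>x. 1/2 * p x + 1/2 * q x) (\<lambda>x. 1/2 * p x + 1/2 * q x)"
      by (simp add: p_def q_def diff_divide_distrib add_divide_distrib algebra_simps)
    moreover have "(\<lambda>x. v n x - v m x) = (\<lambda>x. 1 * q x + (-1) * p x)"
      by (auto simp: p_def q_def)
    ultimately show ?thesis
      using v(2)[of n] v(2)[of m] ip_comb[OF pq, of "1/2" "1/2"] ip_comb[OF pq(2,1), of 1 "-1"] ip_commute[OF pq]
      unfolding p_def[symmetric] q_def[symmetric] by (simp add: power2_eq_square)
  qed
  have "MCauchy v"
    unfolding MCauchy_def
  proof (intro conjI allI impI)
    fix e :: real assume e: "e > 0"
    obtain N where N: "4 / real (Suc N) < e\<^sup>2"
      using reals_Archimedean[of "e\<^sup>2 / 4"] e by (auto simp: field_simps)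
    show "\<exists>N. \<forall>n n'. N \<le> n \<longrightarrow> N \<le> n' \<longrightarrow> ip_dist ip (v n) (v n') < e"
    proof (intro exI[of _ N] allI impI)
      fix n m assume nm: "N \<le> n" "N \<le> m"
      have "2 / real (Suc n) \<le> 2 / real (Suc N)" "2 / real (Suc m) \<le> 2 / real (Suc N)"
        using nm by (auto intro!: divide_left_mono)
      then have "ip (\<lambda>x. v n x - v m x) (\<lambda>x. v n x - v m x) < e\<^sup>2"
        using para[of n m] N by linarith
      then show "ip_dist ip (v n) (v m) < e"
        unfolding ip_dist_def using e by (simp add: real_less_lsqrt ip_nonneg)
    qed
  qed (use vH in auto)
  then obtain g where lim: "limitin mtopology v g sequentially"
    using is_rkhsD(2)[OF k] by (auto simp: mcomplete_def)
  then have g: "g \<in> H" by (simp add: limitin_metric)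
  define p where "p = (\<lambda>x. f x - g x)"
  have p: "p \<in> H" unfolding p_def by (intro diff_mem f g)
  have orth: "ip p w = 0" if w: "w \<in> V" for w
  proof -
    have wH: "w \<in> H" using w VH by auto
    have main: "0 \<le> c\<^sup>2 * ip w w - 2 * c * ip p w" for c
    proof -
      have "D \<le> ?N (v n) - 2 * c * (ip f w - ip (v n) w) + c\<^sup>2 * ip w w" for n
      proof -
        have "(\<lambda>x. v n x + c * w x) \<in> V"
          unfolding V_def by (rule function_span_add) (use v(1)[of n] w in \<open>simp_all add: V_def\<close>)
        from D_le[OF this] have "D \<le> ip (\<lambda>x. 1 * (f x - v n x) + (-c) * w x) (\<lambda>x. 1 * (f x - v n x) + (-c) * w x)"
          by (simp add: algebra_simps)
        then show ?thesis
          unfolding ip_comb[OF diff_mem[OF f vH] wH] diff_left[OF f vH wH] by simp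
      qed
      then have "D \<le> (D + 1 / Suc n) - 2 * c * (ip f w - ip (v n) w) + c\<^sup>2 * ip w w" for n
        using v(2)[of n] by (meson add_mono_thms_linordered_semiring(3) add_right_mono diff_right_mono less_imp_le order.trans)
      moreover have "(\<lambda>n. (D + 1 / Suc n) - 2 * c * (ip f w - ip (v n) w) + c\<^sup>2 * ip w w)
          \<longlonglongrightarrow> (D + 0) - 2 * c * (ip f w - ip g w) + c\<^sup>2 * ip w w"
        by (intro tendsto_intros LIMSEQ_Suc[OF lim_1_over_n] limit_imp_ip_tendsto[OF lim]) (use vH wH in auto)
      ultimately have "D \<le> (D + 0) - 2 * c * (ip f w - ip g w) + c\<^sup>2 * ip w w"
        by (intro LIMSEQ_le_const) auto
      then show ?thesis by (simp add: p_def diff_left f g wH)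
    qed
    \<comment> \<open>At this \<open>c\<close> the quadratic polynomial is negative unless \<open>ip p w = 0\<close>; the
      denominator \<open>W + 1\<close> instead of \<open>W\<close> covers \<open>w = 0\<close>.\<close>
    define s W where "s = ip p w" and "W = ip w w"
    have W: "W \<ge> 0" by (simp add: W_def ip_nonneg)
    define q where "q = s / (W + 1)"
    have q: "s = q * (W + 1)" using W by (simp add: q_def)
    have "0 \<le> q\<^sup>2 * W - 2 * q * s"
      using main[of q] by (simp add: s_def W_def)
    also have "\<dots> = - (q\<^sup>2 * (W + 2))"
      by (simp add: q power2_eq_square algebra_simps)
    finally have "q = 0" using W by (auto simp: mult_le_0_iff)
    then have "s = 0" by (simp add: q)
    then show ?thesis by (simp add: s_def)
  qed
  have "p t = 0" for t
    using is_rkhsD(4)[OF k p, of t] orth[of "\<lambda>s. k s t"] function_span_base[of "\<lambda>t s. k s t"]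
    by (simp add: V_def)
  then have "g = f" by (auto simp: p_def)
  with v lim that show thesis by (auto simp: V_def)
qed

text \<open>
  On the span of the kernel sections the reproducing property expresses the inner product by values
  of the functions, so it does not depend on the ambient space.
\<close>

lemma ip_eq_on_kernel_span:
  assumes "is_rkhs k (H1, ip1)" "is_rkhs k (H2, ip2)"
    and "v \<in> function_span (\<lambda>t s. k s t)" "w \<in> function_span (\<lambda>t s. k s t)"
  shows "ip1 v w = ip2 v w"
proof -
  obtain I c where v: "v = (\<lambda>s. \<Sum>t\<in>I. c t * k s t)" "finite I"
    using assms(3) by (auto simp: function_span_def)
  have *: "ip v w = (\<Sum>t\<in>I. c t * w t)" if k: "is_rkhs k (H, ip)" for H ip
  proof -
    interpret inner_product_functions H ip using is_rkhsD(1)[OF k] .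
    have w: "w \<in> H"
      using assms(4) function_span_subset[of "\<lambda>t s. k s t"] is_rkhsD(3)[OF k] by blast
    have "ip (\<lambda>s. k s t) w = w t" for t
      using is_rkhsD(4)[OF k w, of t] ip_commute[OF w is_rkhsD(3)[OF k]] by simp
    then show ?thesis
      unfolding v using sum_left[OF v(2) is_rkhsD(3)[OF k] w, of c "\<lambda>t. t"] by simp
  qed
  show ?thesis using *[OF assms(1)] *[OF assms(2)] by simp
qed

text \<open>
  A sequence in the span of the kernel sections that converges to \<open>f\<close> in one space is Cauchy in the
  other one. Its limit there is \<open>f\<close> again, since both limits are pointwise limits.
\<close>

lemma is_rkhs_subset:
  assumes k1: "is_rkhs k (H1, ip1)" and k2: "is_rkhs k (H2, ip2)" and f: "f \<in> H1"
  shows "f \<in> H2" "ip2 f f = ip1 f f"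
proof -
  interpret H1: inner_product_functions H1 ip1 using is_rkhsD(1)[OF k1] .
  interpret H2: inner_product_functions H2 ip2 using is_rkhsD(1)[OF k2] .
  let ?V = "function_span (\<lambda>t s. k s t)"
  have V1: "?V \<subseteq> H1" and V2: "?V \<subseteq> H2"
    by (rule H1.function_span_subset is_rkhsD(3)[OF k1] H2.function_span_subset is_rkhsD(3)[OF k2])+
  note ips = ip_eq_on_kernel_span[OF k1 k2]
  obtain v where v: "\<And>n. v n \<in> ?V" and lim1: "limitin H1.mtopology v f sequentially"
    by (rule kernel_span_dense[OF k1 f]) (rule that)
  have r1: "range v \<subseteq> H1" and r2: "range v \<subseteq> H2" using v V1 V2 by blast+
  have "ip_dist ip1 (v n) (v m) = ip_dist ip2 (v n) (v m)" for n m
  proof -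
    have "(\<lambda>x. v n x - v m x) \<in> ?V"
      using function_span_add[OF v v, of n "-1" m] by simp
    then show ?thesis by (simp add: ip_dist_def ips)
  qed
  then have "H2.MCauchy v"
    using H1.convergent_imp_MCauchy[OF r1 lim1] r2 by (simp add: H1.MCauchy_def H2.MCauchy_def)
  then obtain g where lim2: "limitin H2.mtopology v g sequentially"
    using is_rkhsD(2)[OF k2] by (auto simp: H2.mcomplete_def)
  then have g: "g \<in> H2" by (simp add: H2.limitin_metric)
  have "f t = g t" for t
  proof (rule LIMSEQ_unique)
    have "v n t = ip1 (v n) (\<lambda>s. k s t)" for n using r1 is_rkhsD(4)[OF k1] by blast
    then show "(\<lambda>n. v n t) \<longlonglongrightarrow> f t"
      using H1.limit_imp_ip_tendsto(2)[OF lim1 r1 is_rkhsD(3)[OF k1], of t] is_rkhsD(4)[OF k1 f] by simp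
    have "v n t = ip2 (v n) (\<lambda>s. k s t)" for n using r2 is_rkhsD(4)[OF k2] by blast
    then show "(\<lambda>n. v n t) \<longlonglongrightarrow> g t"
      using H2.limit_imp_ip_tendsto(2)[OF lim2 r2 is_rkhsD(3)[OF k2], of t] is_rkhsD(4)[OF k2 g] by simp
  qed
  then have fg: "f = g" by blast
  with g show "f \<in> H2" by simp
  show "ip2 f f = ip1 f f"
    using H1.limit_imp_ip_tendsto(1)[OF lim1 r1] H2.limit_imp_ip_tendsto(1)[OF lim2 r2]
    unfolding ips[OF v v] fg by (rule LIMSEQ_unique[rotated])
qed

theorem is_rkhs_unique:
  assumes k1: "is_rkhs k (H1, ip1)" and k2: "is_rkhs k (H2, ip2)"
  shows "H1 = H2 \<and> ip1 = ip2"
proof -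
  interpret H1: inner_product_functions H1 ip1 using is_rkhsD(1)[OF k1] .
  interpret H2: inner_product_functions H2 ip2 using is_rkhsD(1)[OF k2] .
  have H: "H1 = H2" using is_rkhs_subset(1)[OF k1 k2] is_rkhs_subset(1)[OF k2 k1] by blast
  have "ip1 f g = ip2 f g" for f g
  proof (cases "f \<in> H1 \<and> g \<in> H1")
    case True
    then have "f \<in> H1" "g \<in> H1" by auto
    then show ?thesis
      using H1.ip_polarize[of f g] H2.ip_polarize[of f g] is_rkhs_subset(2)[OF k1 k2] H1.add_mem[of f g]
      by (simp add: H)
  next
    case False
    then show ?thesis using H1.outside H2.outside H by auto
  qed
  with H show ?thesis by blast
qed

lemma rkhs_eq:
  assumes "is_rkhs k (H, ip)"
  shows "rkhs k = (H, ip)"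
  unfolding rkhs_def
proof (rule the_equality)
  show "is_rkhs k (H, ip)" by (rule assms)
  show "V = (H, ip)" if "is_rkhs k V" for V
    using is_rkhs_unique[OF assms, of "fst V" "snd V"] that by (cases V) auto
qed

section \<open>Square-summable sequences\<close>

definition l2 :: "(nat \<Rightarrow> real) set" where
  "l2 = {a. summable (\<lambda>n. (a n)\<^sup>2)}"

definition l2_ip :: "(nat \<Rightarrow> real) \<Rightarrow> (nat \<Rightarrow> real) \<Rightarrow> real" where
  "l2_ip a b = (if a \<in> l2 \<and> b \<in> l2 then \<Sum>n. a n * b n else 0)"

lemma l2_summable_mult:
  assumes "a \<in> l2" "b \<in> l2"
  shows "summable (\<lambda>n. a n * b n)"
proof (rule summable_comparison_test')
  show "summable (\<lambda>n. (a n)\<^sup>2 + (b n)\<^sup>2)"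
    using assms by (intro summable_add) (auto simp: l2_def)
  show "norm (a n * b n) \<le> (a n)\<^sup>2 + (b n)\<^sup>2" for n
  proof -
    have "2 * (\<bar>a n\<bar> * \<bar>b n\<bar>) \<le> (a n)\<^sup>2 + (b n)\<^sup>2"
      using sum_squares_bound[of "\<bar>a n\<bar>" "\<bar>b n\<bar>"] by (simp add: mult.assoc)
    moreover have "0 \<le> \<bar>a n\<bar> * \<bar>b n\<bar>" by simp
    ultimately show ?thesis unfolding real_norm_def abs_mult by linarith
  qed
qed

lemma l2_zero: "(\<lambda>n. 0) \<in> l2"
  by (simp add: l2_def)

lemma l2_add:
  assumes "a \<in> l2" "b \<in> l2"
  shows "(\<lambda>n. a n + b n) \<in> l2"
  using assms l2_summable_mult[OF assms]
  by (simp add: l2_def power2_sum mult.assoc summable_add summable_mult)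

lemma l2_scale: "a \<in> l2 \<Longrightarrow> (\<lambda>n. c * a n) \<in> l2"
  by (simp add: l2_def power_mult_distrib summable_mult)

lemma inner_product_function_space_l2: "inner_product_function_space l2 l2_ip"
  unfolding inner_product_function_space_def
proof (intro conjI ballI allI impI)
  fix a b c :: "nat \<Rightarrow> real" and r :: real
  assume a: "a \<in> l2"
  show "0 \<le> l2_ip a a"
    using l2_summable_mult[OF a a] by (simp add: l2_ip_def suminf_nonneg)
  show "a = (\<lambda>x. 0)" if "l2_ip a a = 0"
    using that a suminf_eq_zero_iff[OF l2_summable_mult[OF a a]] by (auto simp: l2_ip_def)
  assume b: "b \<in> l2"
  show "l2_ip a b = l2_ip b a" by (simp add: l2_ip_def mult.commute)
  show "l2_ip (\<lambda>x. r * a x) b = r * l2_ip a b"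
    using suminf_mult[OF l2_summable_mult[OF a b], of r] a b
    by (simp add: l2_ip_def l2_scale mult.assoc)
  assume c: "c \<in> l2"
  show "l2_ip (\<lambda>x. a x + b x) c = l2_ip a c + l2_ip b c"
    using suminf_add[OF l2_summable_mult[OF a c] l2_summable_mult[OF b c]] a b c
    by (simp add: l2_ip_def l2_add distrib_right)
qed (auto simp: l2_zero l2_add l2_scale l2_ip_def)

interpretation l2: inner_product_functions l2 l2_ip
  by standard (rule inner_product_function_space_l2)

lemma l2_partial_le_ip:
  assumes "a \<in> l2"
  shows "(\<Sum>n<N. (a n)\<^sup>2) \<le> l2_ip a a"
  using assms sum_le_suminf[of "\<lambda>n. (a n)\<^sup>2" "{..<N}"]
  by (simp add: l2_ip_def l2_def power2_eq_square)

text \<open>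
  A Cauchy sequence converges coordinatewise to some \<open>a\<close>. The bound on the distance of
  two members is inherited by finite sums of squared coordinates, in which the second member may be replaced by \<open>a\<close>;
  letting the number of coordinates grow gives convergence in norm.
\<close>

lemma l2_mcomplete: "Metric_space.mcomplete l2 (ip_dist l2_ip)"
  unfolding l2.mcomplete_def
proof (intro allI impI)
  fix \<sigma> assume \<sigma>: "l2.MCauchy \<sigma>"
  then have \<sigma>l2: "\<sigma> i \<in> l2" for i
    unfolding l2.MCauchy_def by blast
  have dist_ge: "(\<Sum>n<N. (\<sigma> i n - \<sigma> j n)\<^sup>2) \<le> (ip_dist l2_ip (\<sigma> i) (\<sigma> j))\<^sup>2" for i j N
    using l2_partial_le_ip[OF l2.diff_mem[OF \<sigma>l2[of i] \<sigma>l2[of j]], of N]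
    unfolding ip_dist_def real_sqrt_pow2[OF l2.ip_nonneg] .
  have Cau: "\<exists>N. \<forall>i\<ge>N. \<forall>j\<ge>N. ip_dist l2_ip (\<sigma> i) (\<sigma> j) < e" if "e > 0" for e
  proof -
    obtain N where "\<forall>i j. N \<le> i \<longrightarrow> N \<le> j \<longrightarrow> ip_dist l2_ip (\<sigma> i) (\<sigma> j) < e"
      using conjunct2[OF \<sigma>[unfolded l2.MCauchy_def], rule_format, OF \<open>e > 0\<close>] by auto
    then show ?thesis by (intro exI[of _ N]) simp
  qed
  have "Cauchy (\<lambda>i. \<sigma> i n)" for n
  proof (rule CauchyI)
    fix e :: real
    have ge: "\<bar>\<sigma> i n - \<sigma> j n\<bar> \<le> ip_dist l2_ip (\<sigma> i) (\<sigma> j)" for i j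
    proof -
      have "(\<sigma> i n - \<sigma> j n)\<^sup>2 \<le> (ip_dist l2_ip (\<sigma> i) (\<sigma> j))\<^sup>2"
        by (rule order.trans[OF member_le_sum[of n "{..<Suc n}"] dist_ge]) auto
      then have "\<bar>\<sigma> i n - \<sigma> j n\<bar> \<le> \<bar>ip_dist l2_ip (\<sigma> i) (\<sigma> j)\<bar>"
        unfolding abs_le_square_iff .
      then show ?thesis by simp
    qed
    assume "e > 0"
    then obtain M where M: "\<forall>i\<ge>M. \<forall>j\<ge>M. ip_dist l2_ip (\<sigma> i) (\<sigma> j) < e"
      using Cau by blast
    have "\<forall>i\<ge>M. \<forall>j\<ge>M. norm (\<sigma> i n - \<sigma> j n) < e"
      using M order.strict_trans1[OF ge] by simp
    then show "\<exists>M. \<forall>i\<ge>M. \<forall>j\<ge>M. norm (\<sigma> i n - \<sigma> j n) < e" ..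
  qed
  then have "(\<lambda>i. \<sigma> i n) \<longlonglongrightarrow> lim (\<lambda>i. \<sigma> i n)" for n
    by (simp add: Cauchy_convergent_iff convergent_LIMSEQ_iff)
  then obtain a where a: "\<And>n. (\<lambda>i. \<sigma> i n) \<longlonglongrightarrow> a n"
    by (rule that)
  have key: "\<exists>N. \<forall>i\<ge>N. (\<lambda>n. \<sigma> i n - a n) \<in> l2 \<and> l2_ip (\<lambda>n. \<sigma> i n - a n) (\<lambda>n. \<sigma> i n - a n) \<le> e\<^sup>2"
    if e: "e > 0" for e
  proof -
    obtain N where N: "\<And>i j. i \<ge> N \<Longrightarrow> j \<ge> N \<Longrightarrow> ip_dist l2_ip (\<sigma> i) (\<sigma> j) < e"
      using Cau[OF e] by blast
    have "(\<lambda>n. \<sigma> i n - a n) \<in> l2 \<and> l2_ip (\<lambda>n. \<sigma> i n - a n) (\<lambda>n. \<sigma> i n - a n) \<le> e\<^sup>2" if i: "i \<ge> N" for i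
    proof -
      have bound: "(\<Sum>n<K. (\<sigma> i n - a n)\<^sup>2) \<le> e\<^sup>2" for K
      proof (rule LIMSEQ_le_const2)
        show "(\<lambda>j. \<Sum>n<K. (\<sigma> i n - \<sigma> j n)\<^sup>2) \<longlonglongrightarrow> (\<Sum>n<K. (\<sigma> i n - a n)\<^sup>2)"
          by (intro tendsto_intros a)
        show "\<exists>N. \<forall>j\<ge>N. (\<Sum>n<K. (\<sigma> i n - \<sigma> j n)\<^sup>2) \<le> e\<^sup>2"
        proof (intro exI[of _ N] allI impI)
          fix j assume "N \<le> j"
          then have "(ip_dist l2_ip (\<sigma> i) (\<sigma> j))\<^sup>2 \<le> e\<^sup>2"
            using N[OF i] by (intro power_mono[OF less_imp_le] l2.nonneg) auto
          with dist_ge show "(\<Sum>n<K. (\<sigma> i n - \<sigma> j n)\<^sup>2) \<le> e\<^sup>2" by (rule order.trans)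
        qed
      qed
      have summ: "summable (\<lambda>n. (\<sigma> i n - a n)\<^sup>2)"
        by (rule bounded_imp_summable[where B = "e\<^sup>2"])
           (use bound[of "Suc n" for n] in \<open>simp_all add: lessThan_Suc_atMost\<close>)
      have "(\<Sum>n. (\<sigma> i n - a n)\<^sup>2) \<le> e\<^sup>2"
        by (rule suminf_le_const[OF summ bound])
      with summ show ?thesis by (simp add: l2_def l2_ip_def power2_eq_square)
    qed
    then show ?thesis by blast
  qed
  obtain i where "(\<lambda>n. \<sigma> i n - a n) \<in> l2"
    using key[OF zero_less_one] by blast
  from l2.diff_mem[OF \<sigma>l2[of i] this] have al2: "a \<in> l2" by simp
  have "limitin l2.mtopology \<sigma> a sequentially"
    unfolding l2.limit_metric_sequentially
  proof (intro conjI allI impI al2)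
    fix e :: real assume e: "e > 0"
    obtain N where N: "\<And>i. i \<ge> N \<Longrightarrow> l2_ip (\<lambda>n. \<sigma> i n - a n) (\<lambda>n. \<sigma> i n - a n) \<le> (e/2)\<^sup>2"
      using key[OF half_gt_zero[OF e]] by blast
    have "ip_dist l2_ip (\<sigma> i) a \<le> e / 2" if "i \<ge> N" for i
      unfolding ip_dist_def by (rule real_le_lsqrt) (use N[OF that] e in simp_all)
    then have "ip_dist l2_ip (\<sigma> i) a < e" if "i \<ge> N" for i
      using that e by fastforce
    with \<sigma>l2 show "\<exists>N. \<forall>n\<ge>N. \<sigma> n \<in> l2 \<and> ip_dist l2_ip (\<sigma> n) a < e"
      by blast
  qed
  then show "\<exists>a. limitin l2.mtopology \<sigma> a sequentially"
    by blast
qed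

section \<open>Orthonormal bases from kernel expansions\<close>

text \<open>
  The Hilbert space with kernel \<open>k\<close> is realized as the image \<open>H\<close> of the square-summable sequences under the
  synthesis map \<open>F\<close>. The kernel section at \<open>t\<close> is \<open>F\<close> applied to \<open>\<lambda>m. b m t\<close>, so that
  the reproducing property is the definition of \<open>F\<close>. Independence makes \<open>F\<close> injective, hence an
  isometry for the transported inner product.
\<close>

theorem orthonormal_basis_rkhs:
  assumes k: "\<And>t u. (\<lambda>m. b m t * b m u) sums k t u"
    and indep: "\<And>a. a \<in> l2 \<Longrightarrow> (\<And>t. (\<lambda>m. a m * b m t) sums 0) \<Longrightarrow> a = (\<lambda>m. 0)"
  shows "orthonormal_basis (rkhs k) b"
proof -
  have bl2: "(\<lambda>m. b m t) \<in> l2" for t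
    using sums_summable[OF k[of t t]] by (simp add: l2_def power2_eq_square)
  define F where "F a = (\<lambda>t. \<Sum>m. a m * b m t)" for a
  have F: "(\<lambda>m. a m * b m t) sums F a t" if "a \<in> l2" for a t
    unfolding F_def using l2_summable_mult[OF that bl2] by (rule summable_sums)
  have F_add: "F (\<lambda>m. a m + c m) = (\<lambda>t. F a t + F c t)" if "a \<in> l2" "c \<in> l2" for a c
  proof
    fix t
    have "(\<lambda>m. (a m + c m) * b m t) sums (F a t + F c t)"
      using sums_add[OF F[OF that(1)] F[OF that(2)]] by (simp add: distrib_right)
    with F[OF l2_add[OF that]] show "F (\<lambda>m. a m + c m) t = F a t + F c t"
      by (rule sums_unique2)
  qed
  have F_scale: "F (\<lambda>m. r * a m) = (\<lambda>t. r * F a t)" if "a \<in> l2" for a r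
  proof
    fix t
    have "(\<lambda>m. (r * a m) * b m t) sums (r * F a t)"
      using sums_mult[OF F[OF that], of r] by (simp add: mult.assoc)
    with F[OF l2_scale[OF that]] show "F (\<lambda>m. r * a m) t = r * F a t"
      by (rule sums_unique2)
  qed
  have F_diff: "F (\<lambda>m. a m - c m) = (\<lambda>t. F a t - F c t)" if "a \<in> l2" "c \<in> l2" for a c
    using F_add[OF that(1) l2_scale[OF that(2), of "-1"]] F_scale[OF that(2), of "-1"] by simp
  have F_zero: "F (\<lambda>m. 0) = (\<lambda>t. 0)" by (simp add: F_def)
  have inj: "inj_on F l2"
  proof (rule inj_onI)
    fix a c assume ac: "a \<in> l2" "c \<in> l2" "F a = F c"
    have "(\<lambda>m. a m - c m) = (\<lambda>m. 0)"
    proof (rule indep)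
      show "(\<lambda>m. (a m - c m) * b m t) sums 0" for t
        using F[OF l2.diff_mem[OF ac(1,2)], of t] F_diff[OF ac(1,2)] ac(3) by simp
    qed (rule l2.diff_mem ac)+
    then show "a = c" by (simp add: fun_eq_iff)
  qed
  define H where "H = F ` l2"
  define C where "C = the_inv_into l2 F"
  define ip where "ip f g = (if f \<in> H \<and> g \<in> H then l2_ip (C f) (C g) else 0)" for f g
  have FH: "F a \<in> H" if "a \<in> l2" for a using that by (simp add: H_def)
  have ipF: "ip (F a) (F c) = l2_ip a c" if "a \<in> l2" "c \<in> l2" for a c
    using that by (simp add: ip_def FH C_def the_inv_into_f_f[OF inj])
  have ball: "(\<forall>f\<in>H. P f) \<longleftrightarrow> (\<forall>a\<in>l2. P (F a))" for P by (simp add: H_def)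
  have ips: "inner_product_function_space H ip"
    unfolding inner_product_function_space_def ball
  proof (intro conjI ballI allI impI)
    show "(\<lambda>x. 0) \<in> H" using FH[OF l2.zero_mem] by (simp add: F_zero)
    show "ip f g = 0" if "f \<notin> H \<or> g \<notin> H" for f g using that by (auto simp: ip_def)
    fix a c d :: "nat \<Rightarrow> real" and r :: real assume a: "a \<in> l2"
    show "(\<lambda>x. r * F a x) \<in> H" using FH[OF l2.scale_mem[OF a]] by (simp add: F_scale a)
    show "0 \<le> ip (F a) (F a)" using a by (simp add: ipF l2.ip_nonneg)
    show "F a = (\<lambda>x. 0)" if "ip (F a) (F a) = 0"
      using that a l2.definite[OF a] F_zero by (simp add: ipF)
    assume c: "c \<in> l2"
    show "(\<lambda>x. F a x + F c x) \<in> H" using FH[OF l2.add_mem[OF a c]] by (simp add: F_add a c)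
    show "ip (F a) (F c) = ip (F c) (F a)" using a c by (simp add: ipF l2.ip_commute)
    show "ip (\<lambda>x. r * F a x) (F c) = r * ip (F a) (F c)"
      using a c by (simp add: ipF l2.scale_mem l2.scale_left flip: F_scale)
    assume d: "d \<in> l2"
    show "ip (\<lambda>x. F a x + F c x) (F d) = ip (F a) (F d) + ip (F c) (F d)"
      using a c d by (simp add: ipF l2.add_mem l2.add_left flip: F_add)
  qed
  interpret inner_product_functions H ip by standard (rule ips)
  have distF: "ip_dist ip (F a) (F c) = ip_dist l2_ip a c" if "a \<in> l2" "c \<in> l2" for a c
    using that by (simp add: ip_dist_def ipF l2.diff_mem flip: F_diff)
  have "mcomplete"
    unfolding mcomplete_def
  proof (intro allI impI)
    fix \<sigma> assume \<sigma>: "MCauchy \<sigma>"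
    then have "\<sigma> n \<in> H" for n unfolding MCauchy_def by blast
    then have "\<forall>n. \<exists>a. a \<in> l2 \<and> \<sigma> n = F a" unfolding H_def by blast
    then have "\<exists>a. \<forall>n. a n \<in> l2 \<and> \<sigma> n = F (a n)" by (rule choice)
    then obtain a where a: "\<And>n. a n \<in> l2" "\<sigma> = (\<lambda>n. F (a n))" by auto
    have "l2.MCauchy a"
      using \<sigma> a(1) unfolding a(2) MCauchy_def l2.MCauchy_def by (auto simp: distF)
    then obtain c where c: "limitin l2.mtopology a c sequentially"
      using l2_mcomplete by (auto simp: l2.mcomplete_def)
    then have "limitin mtopology \<sigma> (F c) sequentially"
      unfolding limit_metric_sequentially l2.limit_metric_sequentially a(2)
      using a(1) by (simp add: FH distF)
    then show "\<exists>f. limitin mtopology \<sigma> f sequentially" by blast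
  qed
  then have hilbert: "hilbert_function_space H ip"
    using ips by (simp add: hilbert_function_space_def)
  have kF: "(\<lambda>s. k s t) = F (\<lambda>m. b m t)" for t
  proof
    show "k s t = F (\<lambda>m. b m t) s" for s
      using k[of s t] F[OF bl2, of t s] by (simp add: mult.commute sums_unique2)
  qed
  have "is_rkhs k (H, ip)"
    unfolding is_rkhs_def using hilbert
    by (auto simp: kF FH bl2 ball ipF) (simp add: l2_ip_def bl2 F_def)
  then have rkhs: "rkhs k = (H, ip)" by (rule rkhs_eq)
  define e where "e i = (\<lambda>m. if m = i then 1 else 0 :: real)" for i :: nat
  have e: "e i \<in> l2" for i
    using summable_single[of i "\<lambda>_. 1::real"] by (simp add: l2_def e_def if_distrib[of "\<lambda>x. x\<^sup>2"] cong: if_cong)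
  have ip_e: "l2_ip (e i) a = a i" if "a \<in> l2" for a i
  proof -
    have "(\<lambda>m. e i m * a m) sums a i"
      using sums_single[of i a] by (simp add: e_def if_distrib[of "\<lambda>x. x * _"] cong: if_cong)
    then show ?thesis using that e by (simp add: l2_ip_def sums_iff)
  qed
  have bF: "b i = F (e i)" for i
  proof
    fix t
    have "(\<lambda>m. e i m * b m t) sums b i t"
      using sums_single[of i "\<lambda>m. b m t"] by (simp add: e_def if_distrib[of "\<lambda>x. x * _"] cong: if_cong)
    then show "b i t = F (e i) t" by (simp add: F_def sums_iff)
  qed
  have dense: "\<exists>g\<in>function_span b. g \<in> mball f r" if f: "f \<in> H" and r: "r > 0" for f r
  proof -
    obtain a where a: "a \<in> l2" "f = F a" using f by (auto simp: H_def)
    then have sa: "summable (\<lambda>m. (a m)\<^sup>2)" by (simp add: l2_def)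
    have "(\<lambda>N. \<Sum>m<N. (a m)\<^sup>2) \<longlonglongrightarrow> (\<Sum>m. (a m)\<^sup>2)"
      by (rule summable_LIMSEQ[OF sa])
    then have "eventually (\<lambda>N. (\<Sum>m. (a m)\<^sup>2) - r\<^sup>2 < (\<Sum>m<N. (a m)\<^sup>2)) sequentially"
      by (rule order_tendstoD) (use r in simp)
    then obtain N where N: "(\<Sum>m. (a m)\<^sup>2) - r\<^sup>2 < (\<Sum>m<N. (a m)\<^sup>2)"
      by (auto simp: eventually_sequentially)
    define c where "c = (\<lambda>m. if m < N then a m else 0)"
    have cc: "(\<lambda>m. (c m)\<^sup>2) sums (\<Sum>m<N. (a m)\<^sup>2)"
      using sums_finite[of "{..<N}" "\<lambda>m. (c m)\<^sup>2"] by (simp add: c_def)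
    then have c: "c \<in> l2" by (simp add: l2_def sums_iff)
    have "(\<lambda>m. c m * b m t) sums (\<Sum>m<N. a m * b m t)" for t
      using sums_finite[of "{..<N}" "\<lambda>m. c m * b m t"] by (simp add: c_def)
    then have "F c = (\<lambda>t. \<Sum>m\<in>{..<N}. a m * b m t)" by (simp add: F_def sums_iff)
    then have span: "F c \<in> function_span b"
      unfolding function_span_def by (intro CollectI exI conjI) auto
    have "(\<lambda>m. (a m)\<^sup>2 - (c m)\<^sup>2) sums ((\<Sum>m. (a m)\<^sup>2) - (\<Sum>m<N. (a m)\<^sup>2))"
      by (rule sums_diff[OF summable_sums[OF sa] cc])
    moreover have "(a m)\<^sup>2 - (c m)\<^sup>2 = (a m - c m) * (a m - c m)" for m
      by (simp add: c_def power2_eq_square)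
    ultimately have "l2_ip (\<lambda>m. a m - c m) (\<lambda>m. a m - c m) < r\<^sup>2"
      using N l2.diff_mem[OF a(1) c] by (simp add: l2_ip_def sums_iff)
    then have "ip_dist l2_ip a c < r"
      unfolding ip_dist_def using r by (simp add: real_less_lsqrt l2.ip_nonneg)
    then show ?thesis using span a c f by (intro bexI[OF _ span]) (simp add: distF FH)
  qed
  show ?thesis
    unfolding rkhs orthonormal_basis_def prod.case metric_closure_of
    using hilbert dense e by (auto simp: bF FH ipF ip_e) (simp_all add: e_def)
qed

section \<open>Hermite polynomials and Mehler's formula\<close>

definition hermite_fps :: "real \<Rightarrow> real fps" where
  "hermite_fps t = Abs_fps (\<lambda>n. hermite n t / fact n)"

text \<open>
  The explicit formula for the Hermite polynomials is a Cauchy product, which says that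
  \<open>hermite_fps t\<close> is \<open>exp (2 * t * X - X\<^sup>2)\<close>. Its derivative encodes the three-term recurrence.
\<close>

lemma hermite_fps_deriv:
  "fps_deriv (hermite_fps t) = (fps_const (2 * t) - 2 * fps_X) * hermite_fps t"
proof -
  \<comment> \<open>The power series of \<open>exp (- X\<^sup>2)\<close>.\<close>
  define E where "E = Abs_fps (\<lambda>n. if even n then (-1) ^ (n div 2) / fact (n div 2) else 0 :: real)"
  have E': "fps_deriv E = - 2 * fps_X * E"
  proof (rule fps_ext)
    fix n
    show "fps_nth (fps_deriv E) n = fps_nth (- 2 * fps_X * E) n"
    proof (cases n)
      case 0
      then show ?thesis by (simp add: E_def)
    next
      case (Suc j)
      have "fps_nth (- 2 * fps_X * E) n = - 2 * fps_nth E j"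
        unfolding Suc mult.assoc
        by (metis fps_mult_left_const_nth fps_X_mult_nth diff_Suc_1 nat.simps(3) fps_const_neg fps_numeral_fps_const)
      also have "\<dots> = fps_nth (fps_deriv E) n"
        by (auto simp: E_def Suc divide_simps elim!: evenE)
      finally show ?thesis by simp
    qed
  qed
  have "hermite_fps t = E * fps_exp (2 * t)"
  proof (rule fps_ext)
    fix n
    have "hermite n t / fact n =
        (\<Sum>k = 0..n div 2. (-1) ^ k / (fact k * fact (n - 2 * k)) * (2 * t) ^ (n - 2 * k))"
      by (simp add: hermite_def)
    also have "\<dots> = (\<Sum>i\<in>(*) 2 ` {0..n div 2}. fps_nth E i * fps_nth (fps_exp (2 * t)) (n - i))"
      by (subst sum.reindex) (auto simp: E_def inj_on_def)
    also have "\<dots> = (\<Sum>i = 0..n. fps_nth E i * fps_nth (fps_exp (2 * t)) (n - i))"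
    proof (rule sum.mono_neutral_left)
      show "\<forall>i\<in>{0..n} - (*) 2 ` {0..n div 2}. fps_nth E i * fps_nth (fps_exp (2 * t)) (n - i) = 0"
        by (auto simp: E_def elim!: evenE)
    qed auto
    finally show "fps_nth (hermite_fps t) n = fps_nth (E * fps_exp (2 * t)) n"
      by (simp add: hermite_fps_def fps_mult_nth)
  qed
  then show ?thesis
    by (simp add: E' algebra_simps)
qed

lemma hermite_0: "hermite 0 t = 1" by (simp add: hermite_def)
lemma hermite_1: "hermite (Suc 0) t = 2 * t" by (simp add: hermite_def)

lemma hermite_Suc_Suc:
  "hermite (Suc (Suc n)) t = 2 * t * hermite (Suc n) t - 2 * real (Suc n) * hermite n t"
proof -
  have "fps_nth (fps_deriv (hermite_fps t)) (Suc n)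
      = 2 * t * fps_nth (hermite_fps t) (Suc n) - 2 * fps_nth (hermite_fps t) n"
    unfolding hermite_fps_deriv left_diff_distrib mult.assoc
    by (simp add: numeral_fps_const)
  then have "real (n + 2) * hermite (Suc (Suc n)) t / fact (Suc (Suc n))
      = 2 * t * hermite (Suc n) t / fact (Suc n) - 2 * hermite n t / fact n"
    by (simp add: hermite_fps_def del: fact_Suc)
  moreover have "fact (Suc (Suc n)) = (real (n + 2)) * fact (Suc n)" "fact (Suc n) = real (Suc n) * fact n"
    by (simp_all add: algebra_simps)
  ultimately show ?thesis
    by (simp add: divide_simps del: fact_Suc)
qed

text \<open>For \<open>n = 0\<close> the truncated \<open>n - 1\<close> is harmless, because of the factor \<open>n\<close>.\<close>

lemma hermite_Suc:
  "hermite (Suc n) t = 2 * t * hermite n t - 2 * real n * hermite (n - 1) t"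
  using hermite_Suc_Suc[of "n - 1" t] by (cases n) (simp_all add: hermite_0 hermite_1)

lemma DERIV_hermite:
  "(hermite n has_real_derivative 2 * real n * hermite (n - 1) t) (at t)"
proof (induction n rule: less_induct)
  case (less n)
  consider "n = 0" | "n = 1" | k where "n = Suc (Suc k)"
    by (metis One_nat_def not0_implies_Suc)
  then show ?case
  proof cases
    case 3
    have *: "hermite n = (\<lambda>t. 2 * t * hermite (Suc k) t - 2 * real (Suc k) * hermite k t)"
      by (rule ext) (simp only: 3 hermite_Suc_Suc)
    have "(hermite n has_real_derivative 2 * hermite (Suc k) t
        + 2 * t * (2 * real (Suc k) * hermite (Suc k - 1) t) - 2 * real (Suc k) * (2 * real k * hermite (k - 1) t)) (at t)"
      unfolding *
      by (rule derivative_eq_intros less.IH refl | simp add: 3)+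
    also have "2 * hermite (Suc k) t
        + 2 * t * (2 * real (Suc k) * hermite (Suc k - 1) t) - 2 * real (Suc k) * (2 * real k * hermite (k - 1) t)
      = 2 * real n * hermite (n - 1) t"
      using arg_cong[OF hermite_Suc[of k t], of "\<lambda>h. 2 * real (Suc k) * h"] by (simp add: 3 algebra_simps)
    finally show ?thesis .
  qed (auto simp: hermite_0[abs_def] hermite_1[abs_def] intro!: derivative_eq_intros)
qed

text \<open>
  For the normalized values \<open>h n = \<bar>hermite n x\<bar> / sqrt (2 ^ n * fact n)\<close> the recurrence reads
  \<open>h (n + 2) \<le> \<epsilon> n * h (n + 1) + h n\<close> with \<open>\<epsilon> n\<close> tending to \<open>0\<close>. A bound \<open>K * A ^ n\<close> is preserved
  as soon as \<open>\<epsilon> n \<le> A - 1 / A\<close>; the constant \<open>K\<close> takes care of the finitely many earlier indices.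
\<close>

lemma hermite_growth:
  assumes "A > 1"
  obtains K where "\<And>n. \<bar>hermite n x\<bar> \<le> K * A ^ n * sqrt (2 ^ n * fact n)"
proof -
  define s where "s n = sqrt (2 ^ n * fact n)" for n :: nat
  have s: "s n > 0" for n by (simp add: s_def)
  have s_Suc: "s (Suc n) = sqrt (2 * real (Suc n)) * s n" for n
    by (simp add: s_def flip: real_sqrt_mult)
  define h where "h n = \<bar>hermite n x\<bar> / s n" for n
  have rec: "h (Suc (Suc n)) \<le> \<bar>x\<bar> * sqrt (2 / real (n + 2)) * h (Suc n) + h n" for n
  proof -
    have "\<bar>hermite (Suc (Suc n)) x\<bar> \<le> 2 * \<bar>x\<bar> * \<bar>hermite (Suc n) x\<bar> + 2 * real (Suc n) * \<bar>hermite n x\<bar>"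
      unfolding hermite_Suc_Suc by (rule order.trans[OF abs_triangle_ineq4]) (simp add: abs_mult)
    then have "h (Suc (Suc n)) \<le> 2 * \<bar>x\<bar> * \<bar>hermite (Suc n) x\<bar> / s (Suc (Suc n))
        + 2 * real (Suc n) * \<bar>hermite n x\<bar> / s (Suc (Suc n))"
      unfolding h_def add_divide_distrib[symmetric] using s[of "Suc (Suc n)"]
      by (intro divide_right_mono) auto
    also have "2 * \<bar>x\<bar> * \<bar>hermite (Suc n) x\<bar> / s (Suc (Suc n)) = \<bar>x\<bar> * (2 / sqrt (2 * real (n + 2))) * h (Suc n)"
      unfolding s_Suc[of "Suc n"] h_def by simp
    also have "2 / sqrt (2 * real (n + 2)) = sqrt (2 / real (n + 2))"
      unfolding real_sqrt_mult real_sqrt_divide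
      by (metis divide_divide_eq_left real_div_sqrt zero_le_numeral)
    also have "2 * real (Suc n) * \<bar>hermite n x\<bar> / s (Suc (Suc n))
        = (2 * real (Suc n) / (sqrt (2 * real (n + 2)) * sqrt (2 * real (Suc n)))) * h n"
      unfolding s_Suc[of "Suc n"] s_Suc[of n] h_def by simp
    also have "\<dots> \<le> 1 * h n"
    proof (rule mult_right_mono)
      have "2 * real (Suc n) = sqrt (2 * real (Suc n)) * sqrt (2 * real (Suc n))" by simp
      also have "\<dots> \<le> sqrt (2 * real (n + 2)) * sqrt (2 * real (Suc n))"
        by (intro mult_right_mono) auto
      finally show "2 * real (Suc n) / (sqrt (2 * real (n + 2)) * sqrt (2 * real (Suc n))) \<le> 1"
        by (simp add: divide_simps)
    qed (use s[of n] in \<open>simp add: h_def\<close>)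
    finally show ?thesis by simp
  qed
  have lim: "(\<lambda>n. \<bar>x\<bar> * sqrt (2 / real (n + 2))) \<longlonglongrightarrow> \<bar>x\<bar> * sqrt 0"
    by (intro tendsto_intros LIMSEQ_ignore_initial_segment[OF lim_const_over_n])
  have d: "A - 1 / A > 0" using assms less_1_mult[OF assms assms] by (simp add: field_simps)
  have "eventually (\<lambda>n. \<bar>x\<bar> * sqrt (2 / real (n + 2)) < A - 1 / A) sequentially"
    using order_tendstoD(2)[OF lim] d by simp
  then obtain N where "\<forall>n\<ge>N. \<bar>x\<bar> * sqrt (2 / real (n + 2)) < A - 1 / A"
    unfolding eventually_sequentially by blast
  then have N: "\<bar>x\<bar> * sqrt (2 / real (n + 2)) \<le> A - 1 / A" if "n \<ge> N" for n
    using that less_imp_le by blast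
  define K where "K = Max ((\<lambda>n. h n / A ^ n) ` {..N + 1})"
  have A0: "A > 0" using assms by simp
  have h0: "h n \<ge> 0" for n using s[of n] by (simp add: h_def)
  have K_ge: "h n / A ^ n \<le> K" if "n \<le> N + 1" for n
    unfolding K_def by (rule Max_ge) (use that in auto)
  have K0: "K \<ge> 0" using K_ge[of 0] h0[of 0] by simp
  have "h n \<le> K * A ^ n" for n
  proof (induction n rule: less_induct)
    case (less n)
    show ?case
    proof (cases "n \<le> N + 1")
      case True
      then show ?thesis using K_ge[of n] A0 by (simp add: field_simps)
    next
      case False
      then have k: "n = Suc (Suc (n - 2))" "n - 2 \<ge> N" by auto
      define k where "k = n - 2"
      note k = k[folded k_def]
      have "h n \<le> \<bar>x\<bar> * sqrt (2 / real (k + 2)) * h (Suc k) + h k"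
        using rec k by simp
      also have "\<dots> \<le> (A - 1 / A) * (K * A ^ Suc k) + K * A ^ k"
        by (intro add_mono mult_mono N k less.IH h0) (use d k in auto)
      also have "\<dots> = K * A ^ n"
        using A0 by (simp add: k field_simps)
      finally show ?thesis .
    qed
  qed
  then have "\<bar>hermite n x\<bar> \<le> K * A ^ n * s n" for n
    unfolding h_def using s[of n] by (metis pos_divide_le_eq)
  then show thesis using that unfolding s_def by blast
qed

text \<open>The variable of this series is the parameter \<open>r\<close> of Mehler's formula; the points are fixed.\<close>

definition mehler_fps :: "real \<Rightarrow> real \<Rightarrow> real fps" where
  "mehler_fps x y = Abs_fps (\<lambda>n. hermite n x * hermite n y / (2 ^ n * fact n))"

text \<open>
  With the shifted series \<open>W x y\<close>, whose coefficients contain \<open>hermite n x * hermite (Suc n) y\<close>, the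
  recurrence gives \<open>W x y = 2 y M - X * W y x\<close> and, with the roles exchanged, \<open>W y x = 2 x M - X * W x y\<close>. These linear
  equations determine \<open>W x y\<close> in terms of \<open>M\<close>. The derivative of \<open>M\<close> involves
  \<open>hermite (Suc n) x * hermite (Suc n) y\<close>; the recurrence, applied to the first factor and then to
  the resulting \<open>hermite (Suc (Suc n)) y\<close>, expresses it by \<open>W x y\<close>, \<open>M\<close> and \<open>fps_deriv M\<close>.
\<close>

lemma mehler_fps_ode:
  "(1 - fps_X\<^sup>2)\<^sup>2 * fps_deriv (mehler_fps x y) =
     (2 * (fps_const x - fps_X * fps_const y) * (fps_const y - fps_X * fps_const x) + fps_X * (1 - fps_X\<^sup>2)) * mehler_fps x y"
proof -
  let ?X = "fps_X :: real fps"
  define M where "M = mehler_fps x y"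
  define W where "W x y = Abs_fps (\<lambda>n. hermite n x * hermite (Suc n) y / (2 ^ n * fact n))" for x y
  have W: "W x y = fps_const (2 * y) * mehler_fps x y - ?X * W y x" for x y
  proof (rule fps_ext)
    fix n
    show "fps_nth (W x y) n = fps_nth (fps_const (2 * y) * mehler_fps x y - ?X * W y x) n"
      by (cases n) (auto simp: W_def mehler_fps_def hermite_0 hermite_1 hermite_Suc_Suc divide_simps,
        simp_all add: algebra_simps)
  qed
  have sym: "mehler_fps y x = M" by (simp add: M_def mehler_fps_def mult.commute)
  have W2: "(1 - ?X\<^sup>2) * W x y = 2 * (fps_const y - ?X * fps_const x) * M"
    using W[of x y] W[of y x] unfolding sym M_def[symmetric]
    by (simp add: numeral_fps_const algebra_simps power2_eq_square)
  have Z: "2 * fps_deriv M = fps_const (2 * x) * W x y - ?X * (fps_const (2 * y) * W x y - 2 * (M + ?X * fps_deriv M))"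
  proof (rule fps_ext)
    fix n
    show "fps_nth (2 * fps_deriv M) n = fps_nth (fps_const (2 * x) * W x y - ?X * (fps_const (2 * y) * W x y - 2 * (M + ?X * fps_deriv M))) n"
    proof (cases n)
      case 0
      then show ?thesis
        by (simp add: M_def W_def mehler_fps_def hermite_0 hermite_1 numeral_fps_const)
    next
      case (Suc j)
      have H: "hermite (Suc n) x = 2 * x * hermite n x - 2 * real n * hermite j x"
        "hermite (Suc n) y = 2 * y * hermite n y - 2 * real n * hermite j y"
        using hermite_Suc_Suc[of j] by (simp_all add: Suc)
      have X: "fps_nth (?X * fps_deriv M) j = real j * fps_nth M j"
        by (cases j) auto
      have f: "fact n = real n * fact j" "(2::real) ^ n = 2 * 2 ^ j" "real n \<noteq> 0" by (simp_all add: Suc)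
      have "fps_nth (2 * fps_deriv M) n = 2 * (real n + 1) * fps_nth M (Suc n)"
        by (simp add: numeral_fps_const)
      also have "\<dots> = hermite (Suc n) x * hermite (Suc n) y / (2 ^ n * fact n)"
        by (simp add: M_def mehler_fps_def divide_simps)
      also have "\<dots> = 2 * x * fps_nth (W x y) n - (2 * y * fps_nth (W x y) j - 2 * (fps_nth M j + real j * fps_nth M j))"
        using f(3) Suc unfolding M_def W_def mehler_fps_def fps_nth_Abs_fps f(1,2)
        unfolding H by (simp add: divide_simps) (simp add: algebra_simps)
      also have "\<dots> = fps_nth (fps_const (2 * x) * W x y - ?X * (fps_const (2 * y) * W x y - 2 * (M + ?X * fps_deriv M))) n"
        using X by (simp add: Suc numeral_fps_const)
      finally show ?thesis .
    qed
  qed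
  define a b where "a = fps_const x" and "b = fps_const y"
  have ab: "fps_const (2 * x) = 2 * a" "fps_const (2 * y) = 2 * b"
    by (simp_all add: a_def b_def numeral_fps_const)
  have "2 * ((1 - ?X\<^sup>2)\<^sup>2 * fps_deriv M) = 2 * ((2 * (a - ?X * b) * (b - ?X * a) + ?X * (1 - ?X\<^sup>2)) * M)"
    using W2 Z unfolding a_def[symmetric] b_def[symmetric] ab by algebra
  then show ?thesis unfolding M_def[symmetric] a_def[symmetric] b_def[symmetric] by simp
qed

lemma fps_conv_radius_mehler: "fps_conv_radius (mehler_fps x y) \<ge> 1"
  unfolding fps_conv_radius_def
proof (rule conv_radius_geI_ex')
  fix r :: real assume r: "0 < r" "ereal r < 1"
  \<comment> \<open>Any \<open>A > 1\<close> with \<open>A\<^sup>2 * r < 1\<close> would do: two factors of growth \<open>A ^ n\<close> face \<open>r ^ n\<close>.\<close>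
  define A where "A = sqrt (sqrt (1 / r))"
  have A: "A > 1" "A\<^sup>2 * r = sqrt r"
    using r by (auto simp: A_def real_sqrt_divide field_simps simp flip: power2_eq_square)
  obtain K where K: "\<And>n. \<bar>hermite n x\<bar> \<le> K * A ^ n * sqrt (2 ^ n * fact n)"
    using hermite_growth[OF A(1)] by blast
  obtain L where L: "\<And>n. \<bar>hermite n y\<bar> \<le> L * A ^ n * sqrt (2 ^ n * fact n)"
    using hermite_growth[OF A(1)] by blast
  have "norm (fps_nth (mehler_fps x y) n * of_real r ^ n) \<le> K * L * (sqrt r) ^ n" for n
  proof -
    have "\<bar>hermite n x\<bar> * \<bar>hermite n y\<bar>
        \<le> (K * A ^ n * sqrt (2 ^ n * fact n)) * (L * A ^ n * sqrt (2 ^ n * fact n))"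
      by (rule mult_mono[OF K L]) (use order.trans[OF abs_ge_zero K] in auto)
    also have "\<dots> = K * L * (A\<^sup>2) ^ n * (2 ^ n * fact n)"
      by (simp add: power_mult[symmetric] mult_2 power_add mult.assoc mult.left_commute)
    finally have "\<bar>hermite n x\<bar> * \<bar>hermite n y\<bar> / (2 ^ n * fact n) \<le> K * L * (A\<^sup>2) ^ n"
      by (simp add: pos_divide_le_eq mult.assoc)
    then have "\<bar>hermite n x\<bar> * \<bar>hermite n y\<bar> / (2 ^ n * fact n) * r ^ n \<le> K * L * (A\<^sup>2) ^ n * r ^ n"
      using r by (intro mult_right_mono) auto
    then show ?thesis
      using r by (simp add: mehler_fps_def abs_mult A(2)[symmetric] power_mult_distrib mult.assoc)
  qed
  moreover have "summable (\<lambda>n. K * L * (sqrt r) ^ n)"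
    using r by (intro summable_mult summable_geometric) auto
  ultimately show "summable (\<lambda>n. fps_nth (mehler_fps x y) n * of_real r ^ n)"
    by (rule summable_comparison_test'[rotated])
qed

theorem mehler:
  assumes r: "\<bar>r\<bar> < 1"
  shows "(\<lambda>n. (r / 2) ^ n / fact n * hermite n x * hermite n y) sums
    (exp ((2 * r * x * y - r\<^sup>2 * (x\<^sup>2 + y\<^sup>2)) / (1 - r\<^sup>2)) / sqrt (1 - r\<^sup>2))"
proof -
  let ?f = "eval_fps (mehler_fps x y)"
  \<comment> \<open>The quotient of the two sides of the formula; by the differential equation its derivative
    vanishes, and its value at \<open>0\<close> is \<open>1\<close>.\<close>
  define g where "g s = ?f s * (sqrt (1 - s\<^sup>2) * exp ((s\<^sup>2 * (x\<^sup>2 + y\<^sup>2) - 2 * s * x * y) / (1 - s\<^sup>2)))" for s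
  have in_disc: "ereal (norm s) < fps_conv_radius (mehler_fps x y)" if "\<bar>s\<bar> < 1" for s :: real
    by (rule order.strict_trans2[OF _ fps_conv_radius_mehler]) (use that in simp)
  have "(g has_real_derivative 0) (at s)" if s: "\<bar>s\<bar> < 1" for s
  proof -
    define d where "d = eval_fps (fps_deriv (mehler_fps x y)) s"
    have s2: "1 - s\<^sup>2 > 0" using s by (simp add: abs_square_less_1)
    have f': "(?f has_field_derivative d) (at s)"
      unfolding d_def by (rule has_field_derivative_eval_fps) (use in_disc[OF s] in simp)
    have cr: "ereal (norm s) < fps_conv_radius (fps_deriv (mehler_fps x y))"
      using in_disc[OF s] fps_conv_radius_deriv[of "mehler_fps x y"] by (rule order.strict_trans2)
    define p where "p = [:x, -y:]"
    define q where "q = [:y, -x:]"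
    define w where "w = [:1, 0, -1::real:]"
    have polys: "fps_of_poly p = fps_const x - fps_X * fps_const y" "fps_of_poly q = fps_const y - fps_X * fps_const x"
      "fps_of_poly w = 1 - fps_X\<^sup>2" "fps_of_poly [:0, 1:] = (fps_X :: real fps)"
      by (simp_all add: p_def q_def w_def fps_of_poly_pCons power2_eq_square mult.commute flip: fps_const_neg)
    have "fps_of_poly (w\<^sup>2) * fps_deriv (mehler_fps x y) = 
        fps_of_poly (2 * p * q + [:0, 1:] * w) * mehler_fps x y"
      by (simp only: fps_of_poly_add fps_of_poly_mult fps_of_poly_power fps_of_poly_numeral polys mehler_fps_ode)
    then have "eval_fps (fps_of_poly (w\<^sup>2) * fps_deriv (mehler_fps x y)) s = 
        eval_fps (fps_of_poly (2 * p * q + [:0, 1:] * w) * mehler_fps x y) s"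
      by simp
    moreover have polys_eval: "poly (w\<^sup>2) s = (1 - s\<^sup>2)\<^sup>2"
      "poly (2 * p * q + [:0, 1:] * w) s = 2 * (x - s * y) * (y - s * x) + s * (1 - s\<^sup>2)"
      by (simp_all add: p_def q_def w_def power2_eq_square) (simp_all add: algebra_simps)
    ultimately have ode: "(1 - s\<^sup>2)\<^sup>2 * d = (2 * (x - s * y) * (y - s * x) + s * (1 - s\<^sup>2)) * ?f s"
      using in_disc[OF s] cr by (simp add: eval_fps_mult polys_eval del: poly_power poly_add poly_mult flip: d_def)
    define E where "E = exp ((s\<^sup>2 * (x\<^sup>2 + y\<^sup>2) - 2 * s * x * y) / (1 - s\<^sup>2))"
    define R where "R = sqrt (1 - s\<^sup>2)"
    have R: "R > 0" "R\<^sup>2 = 1 - s\<^sup>2" using s2 by (simp_all add: R_def)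
    define e' where "e' = ((2 * s * (x\<^sup>2 + y\<^sup>2) - 2 * x * y) * (1 - s\<^sup>2) - (s\<^sup>2 * (x\<^sup>2 + y\<^sup>2) - 2 * s * x * y) * (- 2 * s)) / (1 - s\<^sup>2)\<^sup>2"
    have "((\<lambda>s. (s\<^sup>2 * (x\<^sup>2 + y\<^sup>2) - 2 * s * x * y) / (1 - s\<^sup>2)) has_real_derivative e') (at s)"
      unfolding e'_def using s2 by (auto intro!: derivative_eq_intros simp: power2_eq_square)
    then have exp': "((\<lambda>s. exp ((s\<^sup>2 * (x\<^sup>2 + y\<^sup>2) - 2 * s * x * y) / (1 - s\<^sup>2))) has_real_derivative E * e') (at s)"
      unfolding E_def by (rule DERIV_fun_exp)
    have sqrt': "((\<lambda>s. sqrt (1 - s\<^sup>2)) has_real_derivative - s / R) (at s)"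
      unfolding R_def using s2 by (auto intro!: derivative_eq_intros simp: field_simps)
    from DERIV_mult[OF f' DERIV_mult[OF sqrt' exp']]
    have "(g has_real_derivative d * (R * E) + ((- s / R) * E + E * e' * R) * ?f s) (at s)"
      unfolding g_def[abs_def] E_def R_def .
    moreover have "d * (R * E) + ((- s / R) * E + E * e' * R) * ?f s = 0"
    proof -
      have e: "(1 - s\<^sup>2)\<^sup>2 * e' = - 2 * (x - s * y) * (y - s * x)"
        using s2 by (simp add: e'_def) (simp add: power2_eq_square algebra_simps)
      have "R * (1 - s\<^sup>2)\<^sup>2 * (d * (R * E) + ((- s / R) * E + E * e' * R) * ?f s)
         = E * (R\<^sup>2 * ((1 - s\<^sup>2)\<^sup>2 * d) - (1 - s\<^sup>2)\<^sup>2 * s * ?f s + R\<^sup>2 * ((1 - s\<^sup>2)\<^sup>2 * e') * ?f s)"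
        using R(1) by (simp add: field_simps power2_eq_square)
      also have "\<dots> = 0"
        unfolding ode e R(2) by (simp add: algebra_simps power2_eq_square)
      finally show ?thesis using R(1) s2 by simp
    qed
    ultimately show ?thesis by simp
  qed
  then have "g r = g 0"
    by (intro DERIV_isconst3[of "-1" 1]) (use r in \<open>auto simp: abs_less_iff\<close>)
  then have 1: "?f r * (sqrt (1 - r\<^sup>2) * exp ((r\<^sup>2 * (x\<^sup>2 + y\<^sup>2) - 2 * r * x * y) / (1 - r\<^sup>2))) = 1"
    by (simp add: g_def eval_fps_at_0 mehler_fps_def hermite_0)
  define z where "z = (r\<^sup>2 * (x\<^sup>2 + y\<^sup>2) - 2 * r * x * y) / (1 - r\<^sup>2)"
  have z: "(2 * r * x * y - r\<^sup>2 * (x\<^sup>2 + y\<^sup>2)) / (1 - r\<^sup>2) = - z"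
    unfolding z_def minus_divide_left by simp
  have "sqrt (1 - r\<^sup>2) > 0" using r by (simp add: abs_square_less_1)
  then have "?f r = exp ((2 * r * x * y - r\<^sup>2 * (x\<^sup>2 + y\<^sup>2)) / (1 - r\<^sup>2)) / sqrt (1 - r\<^sup>2)"
    using 1 unfolding z z_def[symmetric] exp_minus by (simp add: field_simps)
  moreover have "(\<lambda>n. fps_nth (mehler_fps x y) n * r ^ n) sums ?f r"
    by (rule sums_eval_fps[OF in_disc[OF r]])
  ultimately show ?thesis
    by (simp add: mehler_fps_def power_divide mult_ac)
qed

section \<open>Orthogonality of the Hermite polynomials\<close>

text \<open>
  Integrability and decay at infinity of products of Hermite polynomials with a Gaussian are needed below. Both
  are linear conditions, so the recurrence reduces them to powers of \<open>x\<close>.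
\<close>

lemma hermite_times_closed:
  fixes Q :: "(real \<Rightarrow> real) \<Rightarrow> bool"
  assumes lin: "\<And>f g a b. Q f \<Longrightarrow> Q g \<Longrightarrow> Q (\<lambda>x. a * f x + b * g x)"
    and base: "\<And>k. Q (\<lambda>x. x ^ k * g x)"
  shows "Q (\<lambda>x. x ^ k * (hermite n x * g x))"
proof (induction n arbitrary: k rule: less_induct)
  case (less n)
  consider "n = 0" | "n = 1" | j where "n = Suc (Suc j)"
    by (metis One_nat_def not0_implies_Suc)
  then show ?case
  proof cases
    case 1
    then show ?thesis using base[of k] by (simp add: hermite_0)
  next
    case 2
    then show ?thesis using lin[OF base[of "Suc k"] base[of "Suc k"], of 2 0] by (simp add: hermite_1 mult_ac)
  next
    case 3
    have "Q (\<lambda>x. 2 * (x ^ Suc k * (hermite (Suc j) x * g x)) + (- 2 * real (Suc j)) * (x ^ k * (hermite j x * g x)))"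
      by (intro lin less.IH) (simp_all add: 3)
    moreover have "x ^ k * (hermite n x * g x) =
        2 * (x ^ Suc k * (hermite (Suc j) x * g x)) + (- 2 * real (Suc j)) * (x ^ k * (hermite j x * g x))" for x
      by (simp add: 3 hermite_Suc_Suc algebra_simps)
    ultimately show ?thesis by simp
  qed
qed

lemma hermite_product_closed:
  fixes Q :: "(real \<Rightarrow> real) \<Rightarrow> bool"
  assumes lin: "\<And>f g a b. Q f \<Longrightarrow> Q g \<Longrightarrow> Q (\<lambda>x. a * f x + b * g x)"
    and base: "\<And>k. Q (\<lambda>x. x ^ k * g x)"
  shows "Q (\<lambda>x. hermite m x * hermite n x * g x)"
proof -
  have "Q (\<lambda>x. x ^ 0 * (hermite m x * (hermite n x * g x)))"
    by (rule hermite_times_closed[where Q = Q, OF lin hermite_times_closed[where Q = Q, OF lin base]])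
  then show ?thesis by (simp add: mult.assoc)
qed

lemma integrable_power_gauss:
  fixes c :: real
  assumes "c > 0"
  shows "integrable lborel (\<lambda>x. x ^ k * exp (- c * x\<^sup>2))"
proof -
  define s where "s = sqrt (1 / (2 * c))"
  have s: "s > 0" "2 * s\<^sup>2 = 1 / c" using assms by (simp_all add: s_def)
  have "integrable lborel (\<lambda>x. normal_density 0 s x * (x - 0) ^ k)"
  proof (cases "even k")
    case True
    then show ?thesis using integrable.intros[OF normal_moment_even[OF s(1), of 0]] by (auto elim!: evenE)
  next
    case False
    then show ?thesis using integrable.intros[OF normal_moment_odd[OF s(1), of 0]] by (auto elim!: oddE)
  qed
  then have "integrable lborel (\<lambda>x. sqrt (2 * pi * s\<^sup>2) * (normal_density 0 s x * (x - 0) ^ k))"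
    by (rule integrable_mult_right)
  moreover have "sqrt (2 * pi * s\<^sup>2) * (normal_density 0 s x * (x - 0) ^ k) = x ^ k * exp (- c * x\<^sup>2)" for x
    using s(1) unfolding normal_density_def s(2) by (simp add: mult_ac)
  ultimately show ?thesis by (simp only:)
qed

lemma integrable_hermite_gauss:
  fixes c :: real
  assumes "c > 0"
  shows "integrable lborel (\<lambda>x. hermite m x * hermite n x * exp (- c * x\<^sup>2))"
  by (rule hermite_product_closed[where Q = "integrable lborel"])
    (auto intro!: integrable_power_gauss[OF assms, simplified])

lemma tendsto_power_gauss:
  "((\<lambda>x. x ^ k * exp (- x\<^sup>2)) \<longlongrightarrow> 0) (at_top :: real filter)" "((\<lambda>x. x ^ k * exp (- x\<^sup>2)) \<longlongrightarrow> 0) (at_bot :: real filter)"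
proof -
  have lim: "((\<lambda>x::real. x ^ k * exp (- x)) \<longlongrightarrow> 0) at_top"
    using tendsto_power_div_exp_0[of k] by (simp add: exp_minus divide_inverse)
  have bound: "\<forall>\<^sub>F x in at_top. norm ((s * x) ^ k * exp (- (s * x)\<^sup>2)) \<le> x ^ k * exp (- x)" if "\<bar>s\<bar> = 1" for s :: real
    using eventually_ge_at_top[of 1]
  proof eventually_elim
    case (elim x)
    have "x \<le> x\<^sup>2" using elim mult_right_mono[of 1 x x] by (simp add: power2_eq_square)
    moreover have "s\<^sup>2 = 1" using that by (metis power2_abs power_one)
    ultimately show ?case
      using elim that by (auto simp: abs_mult power_abs power_mult_distrib intro!: mult_left_mono)
  qed
  show top: "((\<lambda>x. x ^ k * exp (- x\<^sup>2)) \<longlongrightarrow> 0) (at_top :: real filter)"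
    using Lim_null_comparison[OF bound[of 1] lim] by simp
  show "((\<lambda>x. x ^ k * exp (- x\<^sup>2)) \<longlongrightarrow> 0) (at_bot :: real filter)"
    using Lim_null_comparison[OF bound[of "-1"] lim] by (simp add: filterlim_at_bot_mirror)
qed

lemma tendsto_hermite_gauss:
  assumes "F = at_top \<or> F = (at_bot :: real filter)"
  shows "((\<lambda>x. hermite m x * hermite n x * exp (- x\<^sup>2)) \<longlongrightarrow> 0) F"
proof (rule hermite_product_closed[where Q = "\<lambda>f. (f \<longlongrightarrow> 0) F"])
  show "((\<lambda>x. a * f x + b * g x) \<longlongrightarrow> 0) F" if "(f \<longlongrightarrow> 0) F" "(g \<longlongrightarrow> 0) F" for f g :: "real \<Rightarrow> real" and a b
    using tendsto_add[OF tendsto_mult_left[OF that(1), of a] tendsto_mult_left[OF that(2), of b]] by simp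
qed (use assms tendsto_power_gauss in auto)

definition hermite_ip :: "nat \<Rightarrow> nat \<Rightarrow> real" where
  "hermite_ip m n = (LINT x|lborel. hermite m x * hermite n x * exp (- x\<^sup>2))"

lemma continuous_hermite: "isCont (hermite n) x"
  using DERIV_hermite by (rule DERIV_isCont)

text \<open>
  Integration by parts: the derivative of \<open>hermite m x * exp (- x\<^sup>2)\<close> is
  \<open>- hermite (Suc m) x * exp (- x\<^sup>2)\<close>, and that of \<open>hermite n\<close> is \<open>2 * n * hermite (n - 1)\<close>.
\<close>

lemma hermite_ip_Suc: "hermite_ip (Suc m) n = 2 * real n * hermite_ip m (n - 1)"
proof -
  let ?E = "\<lambda>x::real. exp (- x\<^sup>2)"
  let ?F = "\<lambda>x. hermite m x * hermite n x * ?E x"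
  let ?f = "\<lambda>x. 2 * real n * (hermite m x * hermite (n - 1) x * ?E x) - hermite (Suc m) x * hermite n x * ?E x"
  have int: "integrable lborel (\<lambda>x. hermite i x * hermite j x * ?E x)" for i j
    using integrable_hermite_gauss[of 1 i j] by simp
  have F: "(?F has_real_derivative ?f x) (at x)" for x
    unfolding hermite_Suc[of m]
    by (auto intro!: derivative_eq_intros DERIV_hermite simp: algebra_simps)
  have "(LBINT x=-\<infinity>..\<infinity>. ?f x) = 0 - 0"
  proof (rule interval_integral_FTC_integrable)
    show "(?F has_vector_derivative ?f x) (at x)" for x
      using F by (simp add: has_real_derivative_iff_has_vector_derivative)
    show "isCont ?f x" for x
      by (intro continuous_intros isCont_o2[OF _ continuous_hermite] continuous_hermite)
    show "set_integrable lborel (einterval (-\<infinity>) \<infinity>) ?f"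
      unfolding set_integrable_def by (simp add: int)
    show "((?F \<circ> real_of_ereal) \<longlongrightarrow> 0) (at_right (-\<infinity>))" "((?F \<circ> real_of_ereal) \<longlongrightarrow> 0) (at_left \<infinity>)"
      using tendsto_hermite_gauss by (simp_all add: ereal_tendsto_simps)
  qed simp
  then have "(LINT x|lborel. ?f x) = 0"
    by (simp add: interval_lebesgue_integral_def set_lebesgue_integral_def)
  then show ?thesis
    unfolding hermite_ip_def by (subst (asm) Bochner_Integration.integral_diff) (simp_all add: int)
qed

lemma hermite_ip_commute: "hermite_ip m n = hermite_ip n m"
  by (simp add: hermite_ip_def mult.commute)

lemma hermite_ip_less: "n < m \<Longrightarrow> hermite_ip m n = 0"
proof (induction n arbitrary: m)
  case 0
  then show ?case by (cases m) (simp_all add: hermite_ip_Suc)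
next
  case (Suc n)
  then show ?case by (cases m) (simp_all add: hermite_ip_Suc)
qed

lemma hermite_ip_orthogonal: "m \<noteq> n \<Longrightarrow> hermite_ip m n = 0"
  using hermite_ip_less[of m n] hermite_ip_less[of n m] hermite_ip_commute[of m n] by (cases "m < n") auto

lemma hermite_ip_self: "hermite_ip n n > 0"
proof (induction n)
  case 0
  have "has_bochner_integral lborel (\<lambda>x. exp (- x\<^sup>2)) (sqrt pi / 2 + sqrt pi / 2 :: real)"
    using has_bochner_integral_even_function[OF gaussian_moment_0] by simp
  then have "hermite_ip 0 0 = sqrt pi"
    by (simp add: hermite_ip_def hermite_0 has_bochner_integral_integral_eq)
  then show ?case by simp
qed (simp add: hermite_ip_Suc)

section \<open>The Gaussian kernel\<close>

lemma gaussian_kernel_expansion: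
  "(\<lambda>m. psi m t * psi m u) sums gaussian_kernel t u"
proof -
  have "(\<lambda>n. (2 * sqrt 2 / 3) * exp (- t\<^sup>2 / 3) * exp (- u\<^sup>2 / 3) *
      (((1/3) / 2) ^ n / fact n * hermite n (2 * t / sqrt 3) * hermite n (2 * u / sqrt 3))) sums
    ((2 * sqrt 2 / 3) * exp (- t\<^sup>2 / 3) * exp (- u\<^sup>2 / 3) *
     (exp ((2 * (1/3) * (2 * t / sqrt 3) * (2 * u / sqrt 3) - (1/3)\<^sup>2 * ((2 * t / sqrt 3)\<^sup>2 + (2 * u / sqrt 3)\<^sup>2)) / (1 - (1/3)\<^sup>2)) / sqrt (1 - (1/3)\<^sup>2)))"
    by (intro sums_mult mehler) simp
  also have "sqrt (1 - (1/3)\<^sup>2) = 2 * sqrt 2 / 3"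
    by (rule real_sqrt_unique) (simp_all add: power_divide power_mult_distrib)
  also have "(2 * (1/3) * (2 * t / sqrt 3) * (2 * u / sqrt 3) - (1/3)\<^sup>2 * ((2 * t / sqrt 3)\<^sup>2 + (2 * u / sqrt 3)\<^sup>2)) / (1 - (1/3)\<^sup>2)
     = t * u - t\<^sup>2 / 6 - u\<^sup>2 / 6"
    by (simp add: power_divide power_mult_distrib field_simps power2_eq_square)
  also have "(2 * sqrt 2 / 3) * exp (- t\<^sup>2 / 3) * exp (- u\<^sup>2 / 3) * (exp (t * u - t\<^sup>2 / 6 - u\<^sup>2 / 6) / (2 * sqrt 2 / 3))
     = exp (- t\<^sup>2 / 3) * exp (- u\<^sup>2 / 3) * exp (t * u - t\<^sup>2 / 6 - u\<^sup>2 / 6)"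
    by simp
  also have "\<dots> = gaussian_kernel t u"
    unfolding gaussian_kernel_def exp_add[symmetric]
    by (rule arg_cong[where f = exp]) (simp add: field_simps power2_eq_square)
  also have "(\<lambda>n. (2 * sqrt 2 / 3) * exp (- t\<^sup>2 / 3) * exp (- u\<^sup>2 / 3) *
      (((1/3) / 2) ^ n / fact n * hermite n (2 * t / sqrt 3) * hermite n (2 * u / sqrt 3))) = (\<lambda>m. psi m t * psi m u)"
  proof
    fix m
    have "sqrt (2 * sqrt 2 / 3) * sqrt (2 * sqrt 2 / 3) = 2 * sqrt 2 / 3"
      "sqrt (1 / (6 ^ m * fact m)) * sqrt (1 / (6 ^ m * fact m)) = ((1/3) / 2) ^ m / (fact m :: real)"
      by (simp_all add: power_divide)
    note c = this
    have "psi m t * psi m u = (sqrt (2 * sqrt 2 / 3) * sqrt (2 * sqrt 2 / 3)) * (sqrt (1 / (6 ^ m * fact m)) * sqrt (1 / (6 ^ m * fact m)))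
      * exp (- t\<^sup>2 / 3) * exp (- u\<^sup>2 / 3) * hermite m (2 * t / sqrt 3) * hermite m (2 * u / sqrt 3)"
      unfolding psi_def by (simp only: mult_ac)
    also have "\<dots> = (2 * sqrt 2 / 3) * exp (- t\<^sup>2 / 3) * exp (- u\<^sup>2 / 3) *
      (((1/3) / 2) ^ m / fact m * hermite m (2 * t / sqrt 3) * hermite m (2 * u / sqrt 3))"
      unfolding c by (simp only: mult_ac)
    finally show "(2 * sqrt 2 / 3) * exp (- t\<^sup>2 / 3) * exp (- u\<^sup>2 / 3) *
      (((1/3) / 2) ^ m / fact m * hermite m (2 * t / sqrt 3) * hermite m (2 * u / sqrt 3)) = psi m t * psi m u" ..
  qed
  finally show ?thesis .
qed

text \<open>
  After the substitution \<open>t = sqrt 3 / 2 * x\<close> the function \<open>psi m\<close> becomes a multiple of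
  \<open>exp (- x\<^sup>2 / 4) * hermite m x\<close>. Its product with \<open>exp (- 3 * x\<^sup>2 / 4) * hermite n x\<close> carries
  the weight for which the Hermite polynomials are orthogonal, and the
  remaining Gaussian keeps the dominating function integrable.
\<close>

lemma psi_l2_independent:
  assumes a: "a \<in> l2" and zero: "\<And>t. (\<lambda>m. a m * psi m t) sums 0"
  shows "a = (\<lambda>m. 0)"
proof
  fix n
  define w where "w m = sqrt (2 * sqrt 2 / 3) * sqrt (1 / (6 ^ m * fact m))" for m
  have psi: "psi m (sqrt 3 / 2 * x) = w m * exp (- x\<^sup>2 / 4) * hermite m x" for m x
    by (simp add: psi_def w_def power_mult_distrib power_divide)
  define s where "s N x = (\<Sum>m<N. a m * psi m (sqrt 3 / 2 * x))" for N x
  define A where "A = sqrt (l2_ip a a)"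
  have bound: "\<bar>s N x\<bar> \<le> A" for N x
  proof -
    have sa: "(\<Sum>m<N. (a m)\<^sup>2) \<le> l2_ip a a" by (rule l2_partial_le_ip[OF a])
    have "(\<lambda>m. (psi m t)\<^sup>2) sums 1" for t
      using gaussian_kernel_expansion[of t t] by (simp add: gaussian_kernel_def power2_eq_square)
    then have sp: "(\<Sum>m<N. (psi m t)\<^sup>2) \<le> 1" for t
      by (metis sum_le_suminf finite_lessThan sums_iff zero_le_power2)
    have "(s N x)\<^sup>2 \<le> (\<Sum>m<N. (a m)\<^sup>2) * (\<Sum>m<N. (psi m (sqrt 3 / 2 * x))\<^sup>2)"
      unfolding s_def by (rule Cauchy_Schwarz_ineq_sum)
    also have "\<dots> \<le> l2_ip a a * 1"
      by (intro mult_mono sa sp sum_nonneg l2.ip_nonneg) simp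
    finally show ?thesis unfolding A_def by (intro real_le_rsqrt) simp
  qed
  define g where "g x = hermite n x * exp (- (3/4) * x\<^sup>2)" for x
  have [measurable]: "hermite m \<in> borel_measurable borel" for m
    by (intro borel_measurable_continuous_onI continuous_at_imp_continuous_on ballI continuous_hermite)
  have g_int: "integrable lborel g"
    using integrable_hermite_gauss[of "3/4" n 0] by (simp add: g_def[abs_def] hermite_0)
  have sg: "s N x * g x = (\<Sum>m<N. a m * w m * (hermite m x * hermite n x * exp (- x\<^sup>2)))" for N x
  proof -
    have e: "exp (- x\<^sup>2) = exp (- x\<^sup>2 / 4) * exp (- (3/4) * x\<^sup>2)"
      unfolding exp_add[symmetric] by (simp add: field_simps)
    show ?thesis
      unfolding s_def psi g_def sum_distrib_right e by (intro sum.cong refl) (simp only: mult_ac)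
  qed
  have int: "integrable lborel (\<lambda>x. hermite i x * hermite j x * exp (- x\<^sup>2))" for i j
    using integrable_hermite_gauss[of 1 i j] by simp
  have "(\<lambda>N. LINT x|lborel. s N x * g x) \<longlonglongrightarrow> (LINT x|(lborel :: real measure). (0 :: real))"
  proof (rule integral_dominated_convergence[where w = "\<lambda>x. A * \<bar>g x\<bar>"])
    show "(\<lambda>x. s N x * g x) \<in> borel_measurable lborel" for N
      unfolding sg by measurable
    show "integrable lborel (\<lambda>x. A * \<bar>g x\<bar>)"
      using g_int by simp
    show "AE x in lborel. (\<lambda>N. s N x * g x) \<longlonglongrightarrow> 0"
    proof (rule AE_I2)
      fix x
      have "(\<lambda>N. s N x) \<longlonglongrightarrow> 0"
        using zero[of "sqrt 3 / 2 * x"] unfolding sums_def s_def .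
      then show "(\<lambda>N. s N x * g x) \<longlonglongrightarrow> 0"
        by (rule tendsto_mult_left_zero)
    qed
    show "AE x in lborel. norm (s N x * g x) \<le> A * \<bar>g x\<bar>" for N
      by (rule AE_I2) (simp add: abs_mult mult_right_mono bound)
  qed simp
  moreover have "(LINT x|lborel. s N x * g x) = a n * w n * hermite_ip n n" if "n < N" for N
  proof -
    have "(LINT x|lborel. s N x * g x) = (\<Sum>m<N. a m * w m * hermite_ip m n)"
      unfolding sg hermite_ip_def by (simp add: int)
    also have "\<dots> = (\<Sum>m\<in>{n}. a m * w m * hermite_ip m n)"
      by (rule sum.mono_neutral_right) (use that hermite_ip_orthogonal in auto)
    finally show ?thesis by simp
  qed
  then have "(\<lambda>N. LINT x|lborel. s N x * g x) \<longlonglongrightarrow> a n * w n * hermite_ip n n"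
    by (intro tendsto_eventually eventually_mono[OF eventually_gt_at_top[of n]]) simp
  ultimately have "a n * w n * hermite_ip n n = (LINT x|(lborel :: real measure). (0 :: real))"
    by (rule LIMSEQ_unique[rotated])
  then have "a n * w n * hermite_ip n n = 0" by simp
  then show "a n = 0"
    using hermite_ip_self[of n] by (simp add: w_def)
qed

theorem mainTheorem4:
  shows "orthonormal_basis (rkhs gaussian_kernel) psi \<and>
    (\<forall>t u. (\<lambda>m. psi m t * psi m u) sums gaussian_kernel t u)"
proof -
  have "orthonormal_basis (rkhs gaussian_kernel) psi"
  proof (rule orthonormal_basis_rkhs)
    show "(\<lambda>m. psi m t * psi m u) sums gaussian_kernel t u" for t u
      by (rule gaussian_kernel_expansion)
    show "a = (\<lambda>m. 0)" if "a \<in> l2" "\<And>t. (\<lambda>m. a m * psi m t) sums 0" for a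
      using that by (rule psi_l2_independent)
  qed
  with gaussian_kernel_expansion show ?thesis by blast
qed

end
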